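(* Let $(M,F)$ be a connected complex Finsler space of complex dimension $2$ with $R_{\bar0k\bar00}=R_{\bar00\bar0k}$ for $k=1,2$, with $|A|\neq0$ (i.e. $A$ not identically zero) and with $\mathbf K$ a nonzero constant on $M$. Then $(M,F)$ is weakly Kähler.
   Context: $M$ is a complex manifold with $\dim_{\mathbb C}M=2$; $T'M$ is its holomorphic tangent bundle with local coordinates $(z^k,\eta^k)_{k=1,2}$; $\widetilde{T'M}$ is $T'M$ minus the zero section. A complex Finsler space $(M,F)$: $F:T'M\to[0,\infty)$ is continuous, $L:=F^2$ is smooth on $\widetilde{T'M}$, $F(z,\eta)=0$ iff $\eta=0$, $F(z,\lambda\eta)=|\lambda|F(z,\eta)$ for all $\lambda\in\mathbb C$, and the Hermitian matrix $g_{i\bar j}:=\partial^2L/\partial\eta^i\partial\bar\eta^j$ is positive definite on $\widetilde{T'M}$. "Connected" means $M$ is connected. Repeated indices are summed over $\{1,2\}$; everything lives on $\widetilde{T'M}$; bars on indices denote conjugation. $(g^{\bar m i})$ is the inverse matrix: $g^{\bar m i}g_{j\bar m}=\delta^i_j$. Chern–Finsler connection: $\dot\partial_k:=\partial/\partial\eta^k$, $N^k_j:=g^{\bar mk}\frac{\partial g_{l\bar m}}{\partial z^j}\eta^l$, $\delta_k:=\frac{\partial}{\partial z^k}-N^j_k\dot\partial_j$, $\delta_{\bar k}:=\overline{\delta_k}$, $L^i_{jk}:=g^{\bar li}\delta_kg_{j\bar l}$, $C^i_{jk}:=g^{\bar li}\dot\partial_kg_{j\bar l}$. Curvature: $R^i_{j\bar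 hk}:=-\delta_{\bar h}L^i_{jk}-\delta_{\bar h}(N^l_k)C^i_{jl}$, $R_{\bar rj\bar hk}:=g_{i\bar r}R^i_{j\bar hk}$. An index $0$ (resp. $\bar0$) means contraction with $\eta$ (resp. $\bar\eta$): $R_{\bar0k\bar00}=R_{\bar rk\bar hj}\bar\eta^r\bar\eta^h\eta^j$, $R_{\bar00\bar0k}=R_{\bar rj\bar hk}\bar\eta^r\eta^j\bar\eta^h$. With $T^i_{jk}:=L^i_{jk}-L^i_{kj}$, the space is weakly Kähler if $g_{i\bar l}T^i_{jk}\eta^j\bar\eta^l=0$. In a fixed local chart: $l^i:=\eta^i/F$, $l_i:=\frac1Fg_{i\bar j}\bar\eta^j$, $g:=\det(g_{i\bar j})$, $m^1:=-l_2/\sqrt g$, $m^2:=l_1/\sqrt g$. Put $A:=m^jm^kl_hC^h_{kj}$ ($|A|$ is independent of the chart; $A\equiv0$ means $g_{i\bar j}$ depends on $z$ only), $J:=l^jl^kl_iL^i_{jk}$. The horizontal curvature invariant is $\mathbf K:=-\frac1F\bar\eta^k\delta_{\bar k}J=R_{\bar rj\bar hk}l^{\bar r}l^jl^{\bar h}l^k$, a chart-independent function on $\widetilde{T'M}$; "$\mathbf K$ is a nonzero constant on $M$" means it is a constant function on $\widetilde{T'M}$ with nonzero value. *)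

theory Defs
  imports "HOL-Analysis.Analysis"
begin

section \<open>Complex surfaces and their holomorphic tangent bundle\<close>

text \<open>The tensor indices 1, 2 are the two elements of the finite type \<^typ>\<open>2\<close>
  (where the numeral 2 denotes 0), so points of the coordinate space have type
  \<^typ>\<open>complex^2\<close> and a repeated index is a sum over \<^term>\<open>UNIV :: 2 set\<close>.\<close>

definition holomorphic_map_on :: "(complex^2 \<Rightarrow> complex^2) \<Rightarrow> (complex^2) set \<Rightarrow> bool" where
  "holomorphic_map_on f S \<longleftrightarrow>
     (\<forall>x\<in>S. \<exists>f'. (f has_derivative f') (at x) \<and> Vector_Spaces.linear (*s) (*s) f')"

type_synonym 'a chart = "'a set \<times> ('a \<Rightarrow> complex^2)"

definition chart_inv :: "'a chart \<Rightarrow> complex^2 \<Rightarrow> 'a" where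
  "chart_inv c = inv_into (fst c) (snd c)"

definition chart_image :: "'a chart \<Rightarrow> (complex^2) set" where
  "chart_image c = snd c ` fst c"

definition is_chart :: "'a::topological_space chart \<Rightarrow> bool" where
  "is_chart c \<longleftrightarrow> open (fst c) \<and> open (chart_image c) \<and>
     homeomorphism (fst c) (chart_image c) (snd c) (chart_inv c)"

definition transition :: "'a chart \<Rightarrow> 'a chart \<Rightarrow> complex^2 \<Rightarrow> complex^2" where
  "transition c d = snd d \<circ> chart_inv c"

definition complex_atlas :: "'a::topological_space chart set \<Rightarrow> bool" where
  "complex_atlas \<A> \<longleftrightarrow>
     (\<forall>c\<in>\<A>. is_chart c) \<and> (\<Union>c\<in>\<A>. fst c) = UNIV \<and>
     (\<forall>c\<in>\<A>. \<forall>d\<in>\<A>. holomorphic_map_on (transition c d) (snd c ` (fst c \<inter> fst d)))"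

text \<open>A holomorphic tangent vector at \<^term>\<open>p\<close> is the family of its components
  \<open>(\<eta>\<^sup>1, \<eta>\<^sup>2)\<close> in all charts around \<^term>\<open>p\<close>, transforming by the Jacobians of the
  transition maps. The components are put to 0 at irrelevant charts, so that the zero vector and
  scalar multiplication are the pointwise ones.\<close>

type_synonym 'a tvec = "'a chart \<Rightarrow> complex^2"

definition tangent_space :: "'a chart set \<Rightarrow> 'a \<Rightarrow> 'a tvec set" where
  "tangent_space \<A> p = {v.
     (\<forall>c. \<not> (c \<in> \<A> \<and> p \<in> fst c) \<longrightarrow> v c = 0) \<and>
     (\<forall>c\<in>\<A>. \<forall>d\<in>\<A>. p \<in> fst c \<inter> fst d \<longrightarrow>
        v d = frechet_derivative (transition c d) (at (snd c p)) (v c))}"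

definition tzero :: "'a tvec" where
  "tzero = (\<lambda>_. 0)"

definition tscale :: "complex \<Rightarrow> 'a tvec \<Rightarrow> 'a tvec" where
  "tscale a v = (\<lambda>c. a *s v c)"

text \<open>The tangent vector \<open>\<eta>\<^sup>k \<partial>/\<partial>z\<^sup>k\<close> at \<^term>\<open>p\<close>, for the coordinates of the chart \<^term>\<open>c\<close>.\<close>

definition tvec_of :: "'a chart set \<Rightarrow> 'a chart \<Rightarrow> 'a \<Rightarrow> complex^2 \<Rightarrow> 'a tvec" where
  "tvec_of \<A> c p \<eta> = (\<lambda>d. if d \<in> \<A> \<and> p \<in> fst d
     then frechet_derivative (transition c d) (at (snd c p)) \<eta> else 0)"


section \<open>Complex Finsler metrics\<close>

text \<open>Local coordinates \<open>(z, \<eta>)\<close> on the tangent bundle.\<close>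

type_synonym coords = "(complex^2) \<times> (complex^2)"

definition slit :: "'a chart \<Rightarrow> coords set" where
  "slit c = chart_image c \<times> (UNIV - {0})"

definition in_chart :: "'a chart set \<Rightarrow> ('a \<Rightarrow> 'a tvec \<Rightarrow> real) \<Rightarrow> 'a chart \<Rightarrow> coords \<Rightarrow> real" where
  "in_chart \<A> F c = (\<lambda>(z, \<eta>). F (chart_inv c z) (tvec_of \<A> c (chart_inv c z) \<eta>))"

text \<open>Real differentiability of class \<open>C\<^sup>k\<close> on an open subset of a finite-dimensional space.\<close>

primrec Ck_on :: "nat \<Rightarrow> ('b::euclidean_space \<Rightarrow> real) \<Rightarrow> 'b set \<Rightarrow> bool" where
  "Ck_on 0 f S \<longleftrightarrow> continuous_on S f"
| "Ck_on (Suc k) f S \<longleftrightarrow> f differentiable_on S \<and>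
     (\<forall>v. Ck_on k (\<lambda>x. frechet_derivative f (at x) v) S)"

definition smooth_on :: "('b::euclidean_space \<Rightarrow> real) \<Rightarrow> 'b set \<Rightarrow> bool" where
  "smooth_on f S \<longleftrightarrow> (\<forall>k. Ck_on k f S)"

text \<open>The Wirtinger derivatives with respect to \<open>z\<^sup>k\<close>, \<open>\<eta>\<^sup>k\<close> and their conjugates.\<close>

definition dz :: "2 \<Rightarrow> (coords \<Rightarrow> complex) \<Rightarrow> coords \<Rightarrow> complex" where
  "dz k f x = (frechet_derivative f (at x) (axis k 1, 0)
     - \<i> * frechet_derivative f (at x) (axis k \<i>, 0)) / 2"

definition dzbar :: "2 \<Rightarrow> (coords \<Rightarrow> complex) \<Rightarrow> coords \<Rightarrow> complex" where
  "dzbar k f x = (frechet_derivative f (at x) (axis k 1, 0)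
     + \<i> * frechet_derivative f (at x) (axis k \<i>, 0)) / 2"

definition deta :: "2 \<Rightarrow> (coords \<Rightarrow> complex) \<Rightarrow> coords \<Rightarrow> complex" where
  "deta k f x = (frechet_derivative f (at x) (0, axis k 1)
     - \<i> * frechet_derivative f (at x) (0, axis k \<i>)) / 2"

definition detabar :: "2 \<Rightarrow> (coords \<Rightarrow> complex) \<Rightarrow> coords \<Rightarrow> complex" where
  "detabar k f x = (frechet_derivative f (at x) (0, axis k 1)
     + \<i> * frechet_derivative f (at x) (0, axis k \<i>)) / 2"

text \<open>From here on, \<^term>\<open>f :: coords \<Rightarrow> real\<close> is the coordinate expression of the Finsler
  function in one chart. Indices are listed in the order (upper, lower), and within each
  group as they are written; the barred ones are not distinguished in the notation.\<close>

definition Lfun :: "(coords \<Rightarrow> real) \<Rightarrow> coords \<Rightarrow> real" where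
  "Lfun f x = (f x)\<^sup>2"

text \<open>\<open>gm f i j\<close> is \<open>g\<close> with lower indices \<open>i\<close>, \<open>j\<close>-bar.\<close>

definition gm :: "(coords \<Rightarrow> real) \<Rightarrow> 2 \<Rightarrow> 2 \<Rightarrow> coords \<Rightarrow> complex" where
  "gm f i j = deta i (detabar j (\<lambda>x. complex_of_real (Lfun f x)))"

definition gmat :: "(coords \<Rightarrow> real) \<Rightarrow> coords \<Rightarrow> complex^2^2" where
  "gmat f x = (\<chi> i j. gm f i j x)"

definition hermitian_pos_def :: "complex^2^2 \<Rightarrow> bool" where
  "hermitian_pos_def G \<longleftrightarrow> (\<forall>i j. G $ j $ i = cnj (G $ i $ j)) \<and>
     (\<forall>v. v \<noteq> 0 \<longrightarrow> Re (\<Sum>i\<in>UNIV. \<Sum>j\<in>UNIV. G $ i $ j * v $ i * cnj (v $ j)) > 0)"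

text \<open>The total space carries the topology and smooth structure making all
  \<open>(z, \<eta>)\<close>-coordinates diffeomorphisms, so continuity of \<open>F\<close> and smoothness of \<open>F\<^sup>2\<close>
  are read off in each chart.\<close>

definition complex_finsler :: "'a::topological_space chart set \<Rightarrow> ('a \<Rightarrow> 'a tvec \<Rightarrow> real) \<Rightarrow> bool" where
  "complex_finsler \<A> F \<longleftrightarrow>
     (\<forall>p. \<forall>v\<in>tangent_space \<A> p. F p v \<ge> 0) \<and>
     (\<forall>c\<in>\<A>. continuous_on (chart_image c \<times> UNIV) (in_chart \<A> F c)) \<and>
     (\<forall>c\<in>\<A>. smooth_on (Lfun (in_chart \<A> F c)) (slit c)) \<and>
     (\<forall>p. \<forall>v\<in>tangent_space \<A> p. F p v = 0 \<longleftrightarrow> v = tzero) \<and>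
     (\<forall>p. \<forall>v\<in>tangent_space \<A> p. \<forall>a. F p (tscale a v) = cmod a * F p v) \<and>
     (\<forall>c\<in>\<A>. \<forall>x\<in>slit c. hermitian_pos_def (gmat (in_chart \<A> F c) x))"


section \<open>Chern--Finsler connection, curvature and invariants\<close>

text \<open>\<open>ginv f m i\<close> is \<open>g\<close> with upper indices \<open>m\<close>-bar, \<open>i\<close>; its defining relation
  \<open>\<Sum>m. g\<^sub>j\<^sub>m ginv\<^sub>m\<^sub>i = \<delta>\<^sub>i\<^sub>j\<close> is \<^term>\<open>gmat f x ** matrix_inv (gmat f x) = mat 1\<close>.\<close>

definition ginv :: "(coords \<Rightarrow> real) \<Rightarrow> 2 \<Rightarrow> 2 \<Rightarrow> coords \<Rightarrow> complex" where
  "ginv f m i x = matrix_inv (gmat f x) $ m $ i"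

definition Nc :: "(coords \<Rightarrow> real) \<Rightarrow> 2 \<Rightarrow> 2 \<Rightarrow> coords \<Rightarrow> complex" where
  "Nc f k j x = (\<Sum>m\<in>UNIV. \<Sum>l\<in>UNIV. ginv f m k x * dz j (gm f l m) x * snd x $ l)"

definition hdel :: "(coords \<Rightarrow> real) \<Rightarrow> 2 \<Rightarrow> (coords \<Rightarrow> complex) \<Rightarrow> coords \<Rightarrow> complex" where
  "hdel f k u x = dz k u x - (\<Sum>j\<in>UNIV. Nc f j k x * deta j u x)"

definition hdelbar :: "(coords \<Rightarrow> real) \<Rightarrow> 2 \<Rightarrow> (coords \<Rightarrow> complex) \<Rightarrow> coords \<Rightarrow> complex" where
  "hdelbar f k u x = dzbar k u x - (\<Sum>j\<in>UNIV. cnj (Nc f j k x) * detabar j u x)"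

definition Lc :: "(coords \<Rightarrow> real) \<Rightarrow> 2 \<Rightarrow> 2 \<Rightarrow> 2 \<Rightarrow> coords \<Rightarrow> complex" where
  "Lc f i j k x = (\<Sum>l\<in>UNIV. ginv f l i x * hdel f k (gm f j l) x)"

definition Cc :: "(coords \<Rightarrow> real) \<Rightarrow> 2 \<Rightarrow> 2 \<Rightarrow> 2 \<Rightarrow> coords \<Rightarrow> complex" where
  "Cc f i j k x = (\<Sum>l\<in>UNIV. ginv f l i x * deta k (gm f j l) x)"

definition Rup :: "(coords \<Rightarrow> real) \<Rightarrow> 2 \<Rightarrow> 2 \<Rightarrow> 2 \<Rightarrow> 2 \<Rightarrow> coords \<Rightarrow> complex" where
  "Rup f i j h k x = - hdelbar f h (Lc f i j k) x
     - (\<Sum>l\<in>UNIV. hdelbar f h (Nc f l k) x * Cc f i j l x)"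

definition Rlow :: "(coords \<Rightarrow> real) \<Rightarrow> 2 \<Rightarrow> 2 \<Rightarrow> 2 \<Rightarrow> 2 \<Rightarrow> coords \<Rightarrow> complex" where
  "Rlow f r j h k x = (\<Sum>i\<in>UNIV. gm f i r x * Rup f i j h k x)"

definition R_0k00 :: "(coords \<Rightarrow> real) \<Rightarrow> 2 \<Rightarrow> coords \<Rightarrow> complex" where
  "R_0k00 f k x = (\<Sum>r\<in>UNIV. \<Sum>h\<in>UNIV. \<Sum>j\<in>UNIV.
     Rlow f r k h j x * cnj (snd x $ r) * cnj (snd x $ h) * snd x $ j)"

definition R_000k :: "(coords \<Rightarrow> real) \<Rightarrow> 2 \<Rightarrow> coords \<Rightarrow> complex" where
  "R_000k f k x = (\<Sum>r\<in>UNIV. \<Sum>j\<in>UNIV. \<Sum>h\<in>UNIV.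
     Rlow f r j h k x * cnj (snd x $ r) * snd x $ j * cnj (snd x $ h))"

definition Tc :: "(coords \<Rightarrow> real) \<Rightarrow> 2 \<Rightarrow> 2 \<Rightarrow> 2 \<Rightarrow> coords \<Rightarrow> complex" where
  "Tc f i j k x = Lc f i j k x - Lc f i k j x"

definition lup :: "(coords \<Rightarrow> real) \<Rightarrow> 2 \<Rightarrow> coords \<Rightarrow> complex" where
  "lup f i x = snd x $ i / of_real (f x)"

definition llow :: "(coords \<Rightarrow> real) \<Rightarrow> 2 \<Rightarrow> coords \<Rightarrow> complex" where
  "llow f i x = (\<Sum>j\<in>UNIV. gm f i j x * cnj (snd x $ j)) / of_real (f x)"

text \<open>The determinant of a positive definite Hermitian matrix is a positive real, on which
  \<^const>\<open>csqrt\<close> is the positive root.\<close>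

definition mup :: "(coords \<Rightarrow> real) \<Rightarrow> 2 \<Rightarrow> coords \<Rightarrow> complex" where
  "mup f i x = (if i = 1 then - llow f 2 x else llow f 1 x) / csqrt (det (gmat f x))"

definition Ainv :: "(coords \<Rightarrow> real) \<Rightarrow> coords \<Rightarrow> complex" where
  "Ainv f x = (\<Sum>j\<in>UNIV. \<Sum>k\<in>UNIV. \<Sum>h\<in>UNIV.
     mup f j x * mup f k x * llow f h x * Cc f h k j x)"

definition Jfun :: "(coords \<Rightarrow> real) \<Rightarrow> coords \<Rightarrow> complex" where
  "Jfun f x = (\<Sum>j\<in>UNIV. \<Sum>k\<in>UNIV. \<Sum>i\<in>UNIV.
     lup f j x * lup f k x * llow f i x * Lc f i j k x)"

definition Kinv :: "(coords \<Rightarrow> real) \<Rightarrow> coords \<Rightarrow> complex" where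
  "Kinv f x = - (1 / of_real (f x)) * (\<Sum>k\<in>UNIV. cnj (snd x $ k) * hdelbar f k (Jfun f) x)"

definition weakly_kaehler :: "'a chart set \<Rightarrow> ('a \<Rightarrow> 'a tvec \<Rightarrow> real) \<Rightarrow> bool" where
  "weakly_kaehler \<A> F \<longleftrightarrow> (\<forall>c\<in>\<A>. \<forall>x\<in>slit c. \<forall>k.
     (\<Sum>i\<in>UNIV. \<Sum>j\<in>UNIV. \<Sum>l\<in>UNIV.
        gm (in_chart \<A> F c) i l x * Tc (in_chart \<A> F c) i j k x * snd x $ j * cnj (snd x $ l)) = 0)"

end

theory Submission
  imports Defs
begin

text \<open>Write \<open>L\<^sub>k = \<partial>L/\<partial>\<eta>\<^sup>k\<close>, and let \<open>u\<close> be the contraction of \<open>\<partial>L/\<partial>z\<^sup>h\<close>-bar with \<open>\<eta>\<^sup>h\<close>-bar. In any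
  complex Finsler space \<open>R\<^sub>0\<^sub>0\<^sub>0\<^sub>k = - \<delta>\<^sub>k u\<close>, while the sum \<open>R\<^sub>0\<^sub>k\<^sub>0\<^sub>0 + R\<^sub>0\<^sub>0\<^sub>0\<^sub>k\<close> is the
  \<open>\<eta>\<^sup>k\<close>-derivative of \<open>K L\<^sup>2\<close>, that is \<open>2 K L L\<^sub>k\<close> when \<open>K\<close> is constant. If both terms agree then
  \<open>\<delta>\<^sub>k u = - K L L\<^sub>k\<close>. The \<open>\<delta>\<^sub>k\<close> commute and kill \<open>L\<close>, so applying \<open>\<delta>\<^sub>j\<close> and antisymmetrising gives
  \<open>K L (\<delta>\<^sub>j L\<^sub>k - \<delta>\<^sub>k L\<^sub>j) = 0\<close>. For \<open>K \<noteq> 0\<close> the difference vanishes; it is the torsion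
  contracted with \<open>g\<close> and the conjugate of \<open>\<eta>\<close>.\<close>

section \<open>Smooth maps between vector spaces\<close>

text \<open>The recursion of \<open>Ck_on\<close> with values in any normed space, so that it also
  covers complex-valued functions such as \<open>gm f i j\<close>.\<close>

primrec Cn_on :: "nat \<Rightarrow> ('b::euclidean_space \<Rightarrow> 'c::real_normed_vector) \<Rightarrow> 'b set \<Rightarrow> bool" where
  "Cn_on 0 f S \<longleftrightarrow> continuous_on S f"
| "Cn_on (Suc n) f S \<longleftrightarrow> f differentiable_on S \<and>
     (\<forall>v. Cn_on n (\<lambda>x. frechet_derivative f (at x) v) S)"

definition Cinf_on :: "('b::euclidean_space \<Rightarrow> 'c::real_normed_vector) \<Rightarrow> 'b set \<Rightarrow> bool" where
  "Cinf_on f S \<longleftrightarrow> (\<forall>n. Cn_on n f S)"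

lemma Cn_on_SucD: "Cn_on (Suc n) f S \<Longrightarrow> Cn_on n f S"
  by (induction n arbitrary: f) (auto intro: differentiable_imp_continuous_on)

lemma has_derivative_Cn_on_Suc:
  assumes "Cn_on (Suc n) f S" "open S" "x \<in> S"
  shows "(f has_derivative frechet_derivative f (at x)) (at x)"
  using assms by (auto simp: differentiable_on_def at_within_open_NO_MATCH frechet_derivative_works[symmetric])

text \<open>The premise \<open>cong\<close> is discharged by \<open>Cn_on_cong\<close> below, whose own proof uses this rule.\<close>

lemma Cn_on_SucI:
  fixes f :: "'b::euclidean_space \<Rightarrow> 'c::real_normed_vector"
  assumes "open S" "\<And>x. x \<in> S \<Longrightarrow> (f has_derivative f' x) (at x)"
    and "\<And>v. Cn_on n (\<lambda>x. f' x v) S"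
    and cong: "\<And>g h :: 'b \<Rightarrow> 'c. (\<And>x. x \<in> S \<Longrightarrow> g x = h x) \<Longrightarrow> Cn_on n g S = Cn_on n h S"
  shows "Cn_on (Suc n) f S"
proof -
  have "frechet_derivative f (at x) = f' x" if "x \<in> S" for x
    using frechet_derivative_at[OF assms(2)[OF that]] by simp
  then have "Cn_on n (\<lambda>x. frechet_derivative f (at x) v) S" for v
    using assms(3)[of v] cong[of "\<lambda>x. frechet_derivative f (at x) v" "\<lambda>x. f' x v"] by simp
  moreover have "f differentiable_on S"
    using assms(2) by (meson differentiable_at_withinI differentiable_def differentiable_on_def)
  ultimately show ?thesis by simp
qed

text \<open>Derivatives at a point of an open set see only nearby values. The induction hypothesis
  is exactly the premise \<open>cong\<close> of \<open>Cn_on_SucI\<close> at the lower order;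
  \<open>Cn_on_SucI'\<close> then has that premise built in.\<close>

lemma Cn_on_cong:
  fixes f :: "'b::euclidean_space \<Rightarrow> 'c::real_normed_vector"
  assumes "open S" "\<And>x. x \<in> S \<Longrightarrow> f x = g x"
  shows "Cn_on n f S = Cn_on n g S"
  using assms(2)
proof (induction n arbitrary: f g)
  case 0
  then show ?case by (simp cong: continuous_on_cong)
next
  case (Suc n)
  have *: "Cn_on (Suc n) g S" if fg: "\<And>x. x \<in> S \<Longrightarrow> f x = g x" and f: "Cn_on (Suc n) f S" for f g :: "'b \<Rightarrow> 'c"
  proof (rule Cn_on_SucI[OF \<open>open S\<close>])
    show "(g has_derivative frechet_derivative f (at x)) (at x)" if "x \<in> S" for x
      using has_derivative_transform_within_open[OF has_derivative_Cn_on_Suc[OF f \<open>open S\<close> that] \<open>open S\<close> that] fg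
      by blast
    show "Cn_on n (\<lambda>x. frechet_derivative f (at x) v) S" for v
      using f by simp
    show "Cn_on n g S = Cn_on n h S" if "\<And>x. x \<in> S \<Longrightarrow> g x = h x" for g h :: "'b \<Rightarrow> 'c"
      by (rule Suc.IH) (rule that)
  qed
  show ?case using *[of f g] *[of g f] Suc.prems by metis
qed

lemmas Cn_on_SucI' = Cn_on_SucI[OF _ _ _ Cn_on_cong]

lemma Cn_on_const: "open S \<Longrightarrow> Cn_on n (\<lambda>x. c) S"
  by (induction n arbitrary: c) (simp_all add: differentiable_on_const)

lemma Cn_on_add:
  assumes "open S" "Cn_on n f S" "Cn_on n g S"
  shows "Cn_on n (\<lambda>x. f x + g x) S"
  using assms(2,3)
proof (induction n arbitrary: f g)
  case 0
  then show ?case by (auto intro!: continuous_intros)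
next
  case (Suc n)
  show ?case
  proof (rule Cn_on_SucI'[OF assms(1)])
    show "((\<lambda>x. f x + g x) has_derivative
        (\<lambda>v. frechet_derivative f (at x) v + frechet_derivative g (at x) v)) (at x)" if "x \<in> S" for x
      using Suc.prems assms(1) that by (intro has_derivative_add has_derivative_Cn_on_Suc)
  qed (use Suc assms(1) in auto)
qed

lemma Cn_on_bounded_linear:
  assumes "open S" "bounded_linear h" "Cn_on n f S"
  shows "Cn_on n (\<lambda>x. h (f x)) S"
  using assms(3)
proof (induction n arbitrary: f)
  case 0
  then show ?case using bounded_linear.continuous_on[OF assms(2)] by auto
next
  case (Suc n)
  show ?case
  proof (rule Cn_on_SucI'[OF assms(1)])
    show "((\<lambda>x. h (f x)) has_derivative (\<lambda>v. h (frechet_derivative f (at x) v))) (at x)" if "x \<in> S" for x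
      using bounded_linear.has_derivative[OF assms(2) has_derivative_Cn_on_Suc[OF Suc.prems assms(1) that]] .
  qed (use Suc assms(1) in auto)
qed

lemma Cn_on_mult:
  fixes f g :: "'b::euclidean_space \<Rightarrow> 'c::real_normed_algebra"
  assumes "open S" "Cn_on n f S" "Cn_on n g S"
  shows "Cn_on n (\<lambda>x. f x * g x) S"
  using assms(2,3)
proof (induction n arbitrary: f g)
  case 0
  then show ?case by (auto intro!: continuous_intros)
next
  case (Suc n)
  show ?case
  proof (rule Cn_on_SucI'[OF assms(1)])
    show "((\<lambda>x. f x * g x) has_derivative
        (\<lambda>v. f x * frechet_derivative g (at x) v + frechet_derivative f (at x) v * g x)) (at x)" if "x \<in> S" for x
      using Suc.prems assms(1) that by (intro has_derivative_mult has_derivative_Cn_on_Suc)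
    show "Cn_on n (\<lambda>x. f x * frechet_derivative g (at x) v + frechet_derivative f (at x) v * g x) S" for v
      using Suc.prems Suc.prems[THEN Cn_on_SucD] by (intro Cn_on_add[OF assms(1)] Suc.IH) auto
  qed (use assms(1) in auto)
qed

lemma Cn_on_inverse:
  fixes f :: "'b::euclidean_space \<Rightarrow> 'c::real_normed_field"
  assumes "open S" "Cn_on n f S" "\<And>x. x \<in> S \<Longrightarrow> f x \<noteq> 0"
  shows "Cn_on n (\<lambda>x. inverse (f x)) S"
  using assms(2)
proof (induction n)
  case 0
  then show ?case using assms(3) by (auto intro!: continuous_intros)
next
  case (Suc n)
  show ?case
  proof (rule Cn_on_SucI'[OF assms(1)])
    show "((\<lambda>x. inverse (f x)) has_derivative
        (\<lambda>v. - (inverse (f x) * frechet_derivative f (at x) v * inverse (f x)))) (at x)" if "x \<in> S" for x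
      using Suc.prems assms that by (intro Deriv.has_derivative_inverse has_derivative_Cn_on_Suc)
    show "Cn_on n (\<lambda>x. - (inverse (f x) * frechet_derivative f (at x) v * inverse (f x))) S" for v
      using Suc.prems Suc.IH[OF Suc.prems[THEN Cn_on_SucD]]
      by (intro Cn_on_bounded_linear[OF assms(1) bounded_linear_minus[OF bounded_linear_ident]]
          Cn_on_mult[OF assms(1)]) auto
  qed (use assms(1) in auto)
qed

text \<open>Only the square of the Finsler function is assumed smooth; this recovers smoothness of
  the function itself. The derivative contains the square root only at the lower order, so the
  induction closes.\<close>

lemma Cn_on_sqrt:
  fixes f :: "'b::euclidean_space \<Rightarrow> real"
  assumes "open S" "Cn_on n f S" "\<And>x. x \<in> S \<Longrightarrow> f x > 0"
  shows "Cn_on n (\<lambda>x. sqrt (f x)) S"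
  using assms(2)
proof (induction n)
  case 0
  then show ?case by (auto intro!: continuous_intros)
next
  case (Suc n)
  show ?case
  proof (rule Cn_on_SucI'[OF assms(1)])
    show "((\<lambda>x. sqrt (f x)) has_derivative
        (\<lambda>v. frechet_derivative f (at x) v * inverse (2 * sqrt (f x)))) (at x)" if "x \<in> S" for x
    proof -
      have "DERIV sqrt (f x) :> inverse (sqrt (f x)) / 2"
        using assms(3)[OF that] by (rule DERIV_real_sqrt)
      from DERIV_compose_FDERIV[OF this has_derivative_Cn_on_Suc[OF Suc.prems assms(1) that]]
      show ?thesis by simp
    qed
    have "Cn_on n (\<lambda>x. 2 * sqrt (f x)) S"
      using Suc.IH[OF Suc.prems[THEN Cn_on_SucD]] assms(1) by (intro Cn_on_mult Cn_on_const)
    then have "Cn_on n (\<lambda>x. inverse (2 * sqrt (f x))) S"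
      using assms(3) by (intro Cn_on_inverse[OF assms(1)]) (auto simp: less_imp_neq[symmetric])
    then show "Cn_on n (\<lambda>x. frechet_derivative f (at x) v * inverse (2 * sqrt (f x))) S" for v
      using Suc.prems by (intro Cn_on_mult[OF assms(1)]) auto
  qed (use assms(1) in auto)
qed

lemma Cn_on_linear:
  assumes "open S" "bounded_linear f"
  shows "Cn_on n f S"
proof (cases n)
  case 0
  then show ?thesis using assms by (simp add: linear_continuous_on)
next
  case (Suc m)
  show ?thesis unfolding Suc
    by (rule Cn_on_SucI'[OF assms(1), of _ "\<lambda>_. f"])
      (auto intro: bounded_linear_imp_has_derivative assms Cn_on_const)
qed

lemma Cn_on_Ck_on: "Cn_on n f S \<longleftrightarrow> Ck_on n f S"
  by (induction n arbitrary: f) auto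

lemma Cinf_on_smooth_on: "Cinf_on f S \<longleftrightarrow> smooth_on f S"
  by (simp add: Cinf_on_def smooth_on_def Cn_on_Ck_on)

lemma has_derivative_Cinf_on:
  assumes "Cinf_on f S" "open S" "x \<in> S"
  shows "(f has_derivative frechet_derivative f (at x)) (at x)"
  using has_derivative_Cn_on_Suc assms unfolding Cinf_on_def by blast

lemma Cinf_on_frechet_derivative:
  "Cinf_on f S \<Longrightarrow> Cinf_on (\<lambda>x. frechet_derivative f (at x) v) S"
  unfolding Cinf_on_def by (metis Cn_on.simps(2))

lemma Cinf_on_continuous: "Cinf_on f S \<Longrightarrow> continuous_on S f"
  unfolding Cinf_on_def by (metis Cn_on.simps(1))

lemma Cinf_on_sum:
  assumes "open S" "\<And>i. i \<in> I \<Longrightarrow> Cinf_on (f i) S"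
  shows "Cinf_on (\<lambda>x. \<Sum>i\<in>I. f i x) S"
  using assms(2)
proof (induction I rule: infinite_finite_induct)
  case (insert i I)
  then have "Cinf_on (\<lambda>x. f i x + (\<Sum>i\<in>I. f i x)) S"
    unfolding Cinf_on_def by (intro allI Cn_on_add[OF assms(1)]) auto
  with insert show ?case by simp
qed (auto simp: Cinf_on_def Cn_on_const assms(1))

section \<open>Symmetry of second derivatives (Schwarz's theorem)\<close>

lemma second_difference_mean_value:
  fixes f :: "'b::euclidean_space \<Rightarrow> real"
  assumes f: "Cinf_on f S" and "open S" and h: "h > 0"
    and inS: "\<And>a b. 0 \<le> a \<Longrightarrow> a \<le> h \<Longrightarrow> 0 \<le> b \<Longrightarrow> b \<le> h \<Longrightarrow> x + a *\<^sub>R v + b *\<^sub>R w \<in> S"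
  shows "\<exists>a b. 0 < a \<and> a < h \<and> 0 < b \<and> b < h \<and>
    f (x + h *\<^sub>R v + h *\<^sub>R w) - f (x + h *\<^sub>R v) - f (x + h *\<^sub>R w) + f x
    = h * h * frechet_derivative (\<lambda>y. frechet_derivative f (at y) v) (at (x + a *\<^sub>R v + b *\<^sub>R w)) w"
proof -
  define D where "D = (\<lambda>u y. frechet_derivative u (at y) :: 'b \<Rightarrow> real)"
  have along: "((\<lambda>t. u (p + t *\<^sub>R d)) has_real_derivative D u (p + t *\<^sub>R d) d) (at t)"
    if "Cinf_on u S" "p + t *\<^sub>R d \<in> S" for u p t d
  proof -
    have hd: "(u has_derivative D u (p + t *\<^sub>R d)) (at (p + t *\<^sub>R d))"
      using has_derivative_Cinf_on[OF that(1) \<open>open S\<close> that(2)] by (simp add: D_def)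
    have "((\<lambda>t. u (p + t *\<^sub>R d)) has_derivative (\<lambda>r. D u (p + t *\<^sub>R d) (r *\<^sub>R d))) (at t)"
      by (rule has_derivative_compose[where f = "\<lambda>t. p + t *\<^sub>R d" and g = u, OF _ hd]) (auto intro!: derivative_eq_intros)
    moreover have "D u (p + t *\<^sub>R d) (r *\<^sub>R d) = D u (p + t *\<^sub>R d) d * r" for r
      using linear_cmul[OF has_derivative_linear[OF hd]] by simp
    ultimately show ?thesis by (simp add: has_field_derivative_def)
  qed
  \<comment> \<open>The mean value theorem in direction \<open>v\<close>, for the difference of
    \<open>f\<close> along two parallel sides. The second use, below, is in direction
    \<open>w\<close> and acts on the derivative just obtained.\<close>
  have "\<exists>a>0. a < h \<and> (f (x + h *\<^sub>R w + h *\<^sub>R v) - f (x + h *\<^sub>R v)) - (f (x + h *\<^sub>R w + 0 *\<^sub>R v) - f (x + 0 *\<^sub>R v))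
      = (h - 0) * (D f (x + h *\<^sub>R w + a *\<^sub>R v) v - D f (x + a *\<^sub>R v) v)"
  proof (rule MVT2[OF h])
    fix a assume a: "0 \<le> a" "a \<le> h"
    show "((\<lambda>a. f (x + h *\<^sub>R w + a *\<^sub>R v) - f (x + a *\<^sub>R v)) has_real_derivative
        D f (x + h *\<^sub>R w + a *\<^sub>R v) v - D f (x + a *\<^sub>R v) v) (at a)"
      using inS[of a h] inS[of a 0] a h by (intro DERIV_diff along f) (auto simp: algebra_simps)
  qed
  then obtain a where a: "0 < a" "a < h" and
    "f (x + h *\<^sub>R v + h *\<^sub>R w) - f (x + h *\<^sub>R v) - f (x + h *\<^sub>R w) + f x
      = h * (D f (x + a *\<^sub>R v + h *\<^sub>R w) v - D f (x + a *\<^sub>R v + 0 *\<^sub>R w) v)"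
    by (auto simp: algebra_simps)
  moreover have "\<exists>b>0. b < h \<and> D f (x + a *\<^sub>R v + h *\<^sub>R w) v - D f (x + a *\<^sub>R v + 0 *\<^sub>R w) v
      = (h - 0) * D (\<lambda>y. D f y v) (x + a *\<^sub>R v + b *\<^sub>R w) w"
  proof (rule MVT2[OF h])
    fix b assume b: "0 \<le> b" "b \<le> h"
    have "Cinf_on (\<lambda>y. D f y v) S"
      using Cinf_on_frechet_derivative[OF f] by (simp add: D_def)
    from along[OF this] inS[of a b] a b
    show "((\<lambda>b. D f (x + a *\<^sub>R v + b *\<^sub>R w) v) has_real_derivative
        D (\<lambda>y. D f y v) (x + a *\<^sub>R v + b *\<^sub>R w) w) (at b)" by auto
  qed
  ultimately show ?thesis unfolding D_def by fastforce
qed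

text \<open>The second difference of \<open>f\<close> over a small parallelogram is symmetric in
  \<open>v\<close> and \<open>w\<close>, and it is the same multiple of either mixed derivative at
  some nearby point. Continuity then rules out distinct values at \<open>x\<close>.\<close>

lemma second_derivative_symmetric_real:
  fixes f :: "'b::euclidean_space \<Rightarrow> real"
  assumes f: "Cinf_on f S" and "open S" and "x \<in> S"
  shows "frechet_derivative (\<lambda>y. frechet_derivative f (at y) v) (at x) w
    = frechet_derivative (\<lambda>y. frechet_derivative f (at y) w) (at x) v"
proof (rule ccontr)
  define P where "P v w y = frechet_derivative (\<lambda>y. frechet_derivative f (at y) v) (at y) w" for v w y
  assume "\<not> ?thesis"
  \<comment> \<open>Half the supposed gap: a common value cannot be closer than this to both second
    derivatives at \<open>x\<close>.\<close>
  then have e: "\<bar>P v w x - P w v x\<bar> / 2 > 0" (is "?e > 0") by (simp add: P_def)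
  have "\<exists>d>0. \<forall>y. dist y x < d \<longrightarrow> y \<in> S \<and> \<bar>P v w y - P v w x\<bar> < ?e" for v w
  proof -
    have "continuous_on S (P v w)"
      using Cinf_on_continuous[OF Cinf_on_frechet_derivative[OF Cinf_on_frechet_derivative[OF f]]]
      by (simp add: P_def)
    then have "isCont (P v w) x" using assms(2,3) by (simp add: continuous_on_eq_continuous_at)
    then obtain d1 where "d1 > 0" "\<forall>y. dist y x < d1 \<longrightarrow> \<bar>P v w y - P v w x\<bar> < ?e"
      using e unfolding continuous_at_eps_delta by (metis dist_real_def)
    moreover obtain d2 where "d2 > 0" "ball x d2 \<subseteq> S"
      using assms(2,3) open_contains_ball by blast
    ultimately show ?thesis by (intro exI[of _ "min d1 d2"]) (auto simp: subset_iff dist_commute)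
  qed note near = this
  obtain d1 where d1: "d1 > 0" "\<And>y. dist y x < d1 \<Longrightarrow> y \<in> S \<and> \<bar>P v w y - P v w x\<bar> < ?e"
    using near[of v w] by blast
  obtain d2 where d2: "d2 > 0" "\<And>y. dist y x < d2 \<Longrightarrow> y \<in> S \<and> \<bar>P w v y - P w v x\<bar> < ?e"
    using near[of w v] by blast
  \<comment> \<open>This scale keeps the whole parallelogram within \<open>min d1 d2\<close> of
    \<open>x\<close>; the added 1 keeps the denominator positive when \<open>v\<close> and
    \<open>w\<close> vanish.\<close>
  define h where "h = min d1 d2 / (norm v + norm w + 1)"
  have h: "h > 0" using d1 d2 by (auto simp: h_def add_nonneg_pos)
  have small: "dist (x + a *\<^sub>R v + b *\<^sub>R w) x < min d1 d2" if "0 \<le> a" "a \<le> h" "0 \<le> b" "b \<le> h" for a b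
  proof -
    have "norm (a *\<^sub>R v + b *\<^sub>R w) \<le> a * norm v + b * norm w"
      using that norm_triangle_ineq[of "a *\<^sub>R v" "b *\<^sub>R w"] by simp
    also have "\<dots> \<le> h * norm v + h * norm w"
      using that by (intro add_mono mult_right_mono) auto
    also have "\<dots> < h * (norm v + norm w + 1)" using h by (simp add: algebra_simps)
    also have "\<dots> = min d1 d2"
      using norm_ge_zero[of v] norm_ge_zero[of w] by (simp add: h_def add_nonneg_eq_0_iff del: norm_ge_zero)
    finally show ?thesis by (simp add: dist_norm add.assoc)
  qed
  have "x + a *\<^sub>R v + b *\<^sub>R w \<in> S" if "0 \<le> a" "a \<le> h" "0 \<le> b" "b \<le> h" for a b
    using small[OF that] d1(2) by simp
  moreover have "x + a *\<^sub>R w + b *\<^sub>R v \<in> S" if "0 \<le> a" "a \<le> h" "0 \<le> b" "b \<le> h" for a b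
    using small[of b a] that d1(2) by (simp add: add_ac)
  ultimately obtain a b a' b' where ab: "0 < a" "a < h" "0 < b" "b < h" "0 < a'" "a' < h" "0 < b'" "b' < h"
    and eq: "f (x + h *\<^sub>R v + h *\<^sub>R w) - f (x + h *\<^sub>R v) - f (x + h *\<^sub>R w) + f x
      = h * h * P v w (x + a *\<^sub>R v + b *\<^sub>R w)"
     "f (x + h *\<^sub>R w + h *\<^sub>R v) - f (x + h *\<^sub>R w) - f (x + h *\<^sub>R v) + f x
      = h * h * P w v (x + a' *\<^sub>R w + b' *\<^sub>R v)"
    using second_difference_mean_value[OF f assms(2) h] unfolding P_def by metis
  have "h * h * P v w (x + a *\<^sub>R v + b *\<^sub>R w) = h * h * P w v (x + a' *\<^sub>R w + b' *\<^sub>R v)"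
    unfolding eq[symmetric] by (simp add: add_ac)
  then have "P v w (x + a *\<^sub>R v + b *\<^sub>R w) = P w v (x + b' *\<^sub>R v + a' *\<^sub>R w)"
    using h by (simp add: add_ac)
  moreover have "\<bar>P v w (x + a *\<^sub>R v + b *\<^sub>R w) - P v w x\<bar> < ?e"
    using small[of a b] ab d1(2) by simp
  moreover have "\<bar>P w v (x + b' *\<^sub>R v + a' *\<^sub>R w) - P w v x\<bar> < ?e"
    using small[of b' a'] ab d2(2) by simp
  ultimately show False by (smt (verit) field_sum_of_halves)
qed

lemma frechet_derivative_bounded_linear:
  assumes "bounded_linear h" "(f has_derivative f') (at x)"
  shows "frechet_derivative (\<lambda>x. h (f x)) (at x) = (\<lambda>v. h (f' v))"
  using frechet_derivative_at[OF bounded_linear.has_derivative[OF assms]] by simp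

lemma frechet_derivative_cong:
  assumes "open S" "x \<in> S" "\<And>y. y \<in> S \<Longrightarrow> f y = g y"
  shows "frechet_derivative f (at x) = frechet_derivative g (at x)"
proof -
  have "(f has_derivative f') (at x) \<longleftrightarrow> (g has_derivative f') (at x)" for f'
    using has_derivative_transform_within_open[of _ f' x UNIV S] assms by metis
  then show ?thesis by (simp add: frechet_derivative_def)
qed

text \<open>Real and imaginary parts are bounded linear, so they commute with differentiation and
  the real case applies to each.\<close>

lemma second_derivative_symmetric:
  fixes f :: "'b::euclidean_space \<Rightarrow> complex"
  assumes f: "Cinf_on f S" and "open S" and "x \<in> S"
  shows "frechet_derivative (\<lambda>y. frechet_derivative f (at y) v) (at x) w
    = frechet_derivative (\<lambda>y. frechet_derivative f (at y) w) (at x) v"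
proof -
  have 1: "h (frechet_derivative (\<lambda>y. frechet_derivative f (at y) v) (at x) w) =
     frechet_derivative (\<lambda>y. frechet_derivative (\<lambda>y. h (f y)) (at y) v) (at x) w"
    if h: "bounded_linear h" for h :: "complex \<Rightarrow> real" and v w
  proof -
    have "frechet_derivative (\<lambda>y. frechet_derivative (\<lambda>y. h (f y)) (at y) v) (at x)
      = frechet_derivative (\<lambda>y. h (frechet_derivative f (at y) v)) (at x)"
      using frechet_derivative_bounded_linear[OF h has_derivative_Cinf_on[OF f \<open>open S\<close>]]
      by (intro frechet_derivative_cong[OF assms(2,3)]) simp
    also have "\<dots> = (\<lambda>w. h (frechet_derivative (\<lambda>y. frechet_derivative f (at y) v) (at x) w))"
      by (intro frechet_derivative_bounded_linear[OF h] has_derivative_Cinf_on[OF Cinf_on_frechet_derivative[OF f] assms(2,3)])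
    finally show ?thesis by simp
  qed
  have 2: "Cinf_on (\<lambda>y. h (f y)) S" if "bounded_linear h" for h :: "complex \<Rightarrow> real"
    using f Cn_on_bounded_linear[OF assms(2) that] by (auto simp: Cinf_on_def)
  show ?thesis
    using 1 2 second_derivative_symmetric_real[OF 2 assms(2,3)] bounded_linear_Re bounded_linear_Im
    by (intro complex_eqI) auto
qed

lemma Cinf_on_const: "open S \<Longrightarrow> Cinf_on (\<lambda>x. c) S"
  by (simp add: Cinf_on_def Cn_on_const)

lemma Cinf_on_linear: "open S \<Longrightarrow> bounded_linear f \<Longrightarrow> Cinf_on f S"
  by (simp add: Cinf_on_def Cn_on_linear)

lemma Cinf_on_bounded_linear: "open S \<Longrightarrow> bounded_linear h \<Longrightarrow> Cinf_on f S \<Longrightarrow> Cinf_on (\<lambda>x. h (f x)) S"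
  by (simp add: Cinf_on_def Cn_on_bounded_linear)

lemma Cinf_on_add: "open S \<Longrightarrow> Cinf_on f S \<Longrightarrow> Cinf_on g S \<Longrightarrow> Cinf_on (\<lambda>x. f x + g x) S"
  by (simp add: Cinf_on_def Cn_on_add)

lemma Cinf_on_mult:
  fixes f g :: "'b::euclidean_space \<Rightarrow> 'c::real_normed_algebra"
  shows "open S \<Longrightarrow> Cinf_on f S \<Longrightarrow> Cinf_on g S \<Longrightarrow> Cinf_on (\<lambda>x. f x * g x) S"
  by (simp add: Cinf_on_def Cn_on_mult)

lemma Cinf_on_inverse:
  fixes f :: "'b::euclidean_space \<Rightarrow> 'c::real_normed_field"
  shows "open S \<Longrightarrow> Cinf_on f S \<Longrightarrow> (\<And>x. x \<in> S \<Longrightarrow> f x \<noteq> 0) \<Longrightarrow> Cinf_on (\<lambda>x. inverse (f x)) S"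
  by (simp add: Cinf_on_def Cn_on_inverse)

lemma Cinf_on_cnj: "open S \<Longrightarrow> Cinf_on f S \<Longrightarrow> Cinf_on (\<lambda>x. cnj (f x)) S"
  by (rule Cinf_on_bounded_linear[OF _ bounded_linear_cnj])

lemma Cinf_on_minus: "open S \<Longrightarrow> Cinf_on f S \<Longrightarrow> Cinf_on (\<lambda>x. - f x) S"
  by (rule Cinf_on_bounded_linear[OF _ bounded_linear_minus[OF bounded_linear_ident]])

lemma Cinf_on_diff: "open S \<Longrightarrow> Cinf_on f S \<Longrightarrow> Cinf_on g S \<Longrightarrow> Cinf_on (\<lambda>x. f x - g x) S"
  using Cinf_on_add[of S f "\<lambda>x. - g x"] Cinf_on_minus[of S g] by simp

lemma Cinf_on_cong: "open S \<Longrightarrow> (\<And>x. x \<in> S \<Longrightarrow> f x = g x) \<Longrightarrow> Cinf_on f S = Cinf_on g S"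
  unfolding Cinf_on_def using Cn_on_cong by blast

section \<open>Derivations of the algebra of smooth functions\<close>

text \<open>The coordinate derivatives, \<open>hdel\<close>, \<open>hdelbar\<close> and
  \<open>Sb\<close> all have this form, so one product rule serves them all. Functions are total;
  the last clause lets identities that hold only on \<open>S\<close> be differentiated.\<close>

definition derivation_on ::
  "'b::euclidean_space set \<Rightarrow> (('b \<Rightarrow> complex) \<Rightarrow> 'b \<Rightarrow> complex) \<Rightarrow> bool" where
  "derivation_on S D \<longleftrightarrow>
     (\<forall>u. Cinf_on u S \<longrightarrow> Cinf_on (D u) S) \<and>
     (\<forall>u v. \<forall>x\<in>S. Cinf_on u S \<longrightarrow> Cinf_on v S \<longrightarrow> D (\<lambda>x. u x + v x) x = D u x + D v x) \<and>
     (\<forall>u v. \<forall>x\<in>S. Cinf_on u S \<longrightarrow> Cinf_on v S \<longrightarrow> D (\<lambda>x. u x * v x) x = D u x * v x + u x * D v x) \<and>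
     (\<forall>c. \<forall>x\<in>S. D (\<lambda>x. c) x = 0) \<and>
     (\<forall>u v. (\<forall>x\<in>S. u x = v x) \<longrightarrow> (\<forall>x\<in>S. D u x = D v x))"

lemma derivation_Cinf: "derivation_on S D \<Longrightarrow> Cinf_on u S \<Longrightarrow> Cinf_on (D u) S"
  by (simp add: derivation_on_def)

lemma derivation_add:
  "derivation_on S D \<Longrightarrow> x \<in> S \<Longrightarrow> Cinf_on u S \<Longrightarrow> Cinf_on v S \<Longrightarrow> D (\<lambda>x. u x + v x) x = D u x + D v x"
  by (simp add: derivation_on_def)

lemma derivation_mult:
  "derivation_on S D \<Longrightarrow> x \<in> S \<Longrightarrow> Cinf_on u S \<Longrightarrow> Cinf_on v S \<Longrightarrow>
   D (\<lambda>x. u x * v x) x = D u x * v x + u x * D v x"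
  by (simp add: derivation_on_def)

lemma derivation_const: "derivation_on S D \<Longrightarrow> x \<in> S \<Longrightarrow> D (\<lambda>x. c) x = 0"
  by (simp add: derivation_on_def)

lemma derivation_cong:
  "derivation_on S D \<Longrightarrow> x \<in> S \<Longrightarrow> (\<And>y. y \<in> S \<Longrightarrow> u y = v y) \<Longrightarrow> D u x = D v x"
  unfolding derivation_on_def by meson

lemma derivation_cmult:
  assumes "derivation_on S D" "x \<in> S" "Cinf_on u S" "open S"
  shows "D (\<lambda>x. c * u x) x = c * D u x"
  using derivation_mult[OF assms(1,2) Cinf_on_const[OF assms(4)] assms(3)] derivation_const[OF assms(1,2)]
  by simp

lemma derivation_diff:
  assumes "derivation_on S D" "x \<in> S" "open S" "Cinf_on u S" "Cinf_on v S"
  shows "D (\<lambda>x. u x - v x) x = D u x - D v x"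
  using derivation_add[OF assms(1,2,4) Cinf_on_minus[OF assms(3,5)]]
    derivation_cmult[OF assms(1,2,5,3), of "-1"] by simp

lemma derivation_sum:
  assumes "derivation_on S D" "x \<in> S" "open S" "finite I" "\<And>i. i \<in> I \<Longrightarrow> Cinf_on (u i) S"
  shows "D (\<lambda>x. \<Sum>i\<in>I. u i x) x = (\<Sum>i\<in>I. D (u i) x)"
  using assms(4,5)
proof (induction I rule: finite_induct)
  case empty
  then show ?case using derivation_const[OF assms(1,2)] by simp
next
  case (insert i I)
  then have "D (\<lambda>x. u i x + (\<Sum>i\<in>I. u i x)) x = D (u i) x + (\<Sum>i\<in>I. D (u i) x)"
    using derivation_add[OF assms(1,2), of "u i" "\<lambda>x. \<Sum>i\<in>I. u i x"] Cinf_on_sum[OF assms(3), of I u]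
    by auto
  with insert show ?case by simp
qed

lemma derivation_sum_mult:
  assumes "derivation_on S D" "x \<in> S" "open S" "finite I"
    and "\<And>i. i \<in> I \<Longrightarrow> Cinf_on (u i) S" "\<And>i. i \<in> I \<Longrightarrow> Cinf_on (v i) S"
  shows "D (\<lambda>x. \<Sum>i\<in>I. u i x * v i x) x = (\<Sum>i\<in>I. D (u i) x * v i x + u i x * D (v i) x)"
  using derivation_sum[OF assms(1-4), of "\<lambda>i x. u i x * v i x"] derivation_mult[OF assms(1,2)] assms(3,5,6)
  by (simp add: Cinf_on_mult)

text \<open>Derivations form a module over the smooth functions. The difference is the shape of
  \<open>hdel\<close> and \<open>hdelbar\<close>: a coordinate derivative minus a vertical
  correction.\<close>

lemma derivation_on_linear_combination:
  assumes "derivation_on S D" "open S" "finite I"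
    and E: "\<And>i. i \<in> I \<Longrightarrow> derivation_on S (E i)" and a: "\<And>i. i \<in> I \<Longrightarrow> Cinf_on (a i) S"
  shows "derivation_on S (\<lambda>u x. D u x - (\<Sum>i\<in>I. a i x * E i u x))"
  unfolding derivation_on_def
proof (intro conjI allI impI ballI)
  fix u v :: "'a \<Rightarrow> complex" and x c
  assume u: "Cinf_on u S"
  show "Cinf_on (\<lambda>x. D u x - (\<Sum>i\<in>I. a i x * E i u x)) S"
    using assms u by (intro Cinf_on_diff Cinf_on_sum Cinf_on_mult derivation_Cinf[where D = D] derivation_Cinf[where D = "E _"]) auto
  assume x: "x \<in> S" and v: "Cinf_on v S"
  show "D (\<lambda>x. u x + v x) x - (\<Sum>i\<in>I. a i x * E i (\<lambda>x. u x + v x) x) =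
      D u x - (\<Sum>i\<in>I. a i x * E i u x) + (D v x - (\<Sum>i\<in>I. a i x * E i v x))"
    using derivation_add[OF assms(1) x u v] derivation_add[OF E x u v]
    by (simp add: sum.distrib algebra_simps)
  show "D (\<lambda>x. u x * v x) x - (\<Sum>i\<in>I. a i x * E i (\<lambda>x. u x * v x) x) =
      (D u x - (\<Sum>i\<in>I. a i x * E i u x)) * v x + u x * (D v x - (\<Sum>i\<in>I. a i x * E i v x))"
    using derivation_mult[OF assms(1) x u v] derivation_mult[OF E x u v]
    by (simp add: sum.distrib algebra_simps sum_distrib_left)
next
  fix x c assume "x \<in> S"
  then show "D (\<lambda>x. c) x - (\<Sum>i\<in>I. a i x * E i (\<lambda>x. c) x) = 0"
    using derivation_const[OF assms(1)] derivation_const[OF E] by simp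
next
  fix u v :: "'a \<Rightarrow> complex" and x assume "\<forall>x\<in>S. u x = v x" "x \<in> S"
  then show "D u x - (\<Sum>i\<in>I. a i x * E i u x) = D v x - (\<Sum>i\<in>I. a i x * E i v x)"
    using derivation_cong[OF assms(1) \<open>x \<in> S\<close>, of u v] derivation_cong[OF E \<open>x \<in> S\<close>, of _ u v] by simp
qed

section \<open>Wirtinger derivatives\<close>

text \<open>The sign of \<open>s\<close> separates derivatives in a coordinate
  (\<open>- \<i>\<close>) from those in its conjugate (\<open>\<i>\<close>), so each rule is proved
  once for all four coordinate operators.\<close>

definition wirtinger :: "complex \<Rightarrow> 'b::euclidean_space \<Rightarrow> 'b \<Rightarrow> ('b \<Rightarrow> complex) \<Rightarrow> 'b \<Rightarrow> complex" where
  "wirtinger s v w u x = (frechet_derivative u (at x) v + s * frechet_derivative u (at x) w) / 2"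

lemma dz_wirtinger: "dz k = wirtinger (- \<i>) (axis k 1, 0) (axis k \<i>, 0)"
  and dzbar_wirtinger: "dzbar k = wirtinger \<i> (axis k 1, 0) (axis k \<i>, 0)"
  and deta_wirtinger: "deta k = wirtinger (- \<i>) (0, axis k 1) (0, axis k \<i>)"
  and detabar_wirtinger: "detabar k = wirtinger \<i> (0, axis k 1) (0, axis k \<i>)"
  by (auto simp: fun_eq_iff wirtinger_def dz_def dzbar_def deta_def detabar_def)

lemma derivation_on_frechet:
  assumes "open S"
  shows "derivation_on S (\<lambda>u x. frechet_derivative u (at x) v)"
  unfolding derivation_on_def
proof (intro conjI allI impI ballI)
  fix u v' :: "'a \<Rightarrow> complex" and x c
  assume u: "Cinf_on u S"
  then show "Cinf_on (\<lambda>x. frechet_derivative u (at x) v) S" by (rule Cinf_on_frechet_derivative)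
  assume x: "x \<in> S" and v: "Cinf_on v' S"
  note d = has_derivative_Cinf_on[OF u assms x] has_derivative_Cinf_on[OF v assms x]
  show "frechet_derivative (\<lambda>x. u x + v' x) (at x) v
      = frechet_derivative u (at x) v + frechet_derivative v' (at x) v"
    using frechet_derivative_at[OF has_derivative_add[OF d]] by (metis (no_types))
  show "frechet_derivative (\<lambda>x. u x * v' x) (at x) v
      = frechet_derivative u (at x) v * v' x + u x * frechet_derivative v' (at x) v"
    using fun_cong[OF frechet_derivative_at[OF has_derivative_mult[OF d]], of v] by (simp add: add.commute)
next
  fix u v' :: "'a \<Rightarrow> complex" and x
  assume "\<forall>x\<in>S. u x = v' x" "x \<in> S"
  then show "frechet_derivative u (at x) v = frechet_derivative v' (at x) v"
    using frechet_derivative_cong[OF assms, of x u v'] by simp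
qed simp

lemma derivation_on_wirtinger:
  assumes "open S"
  shows "derivation_on S (wirtinger s v w)"
proof -
  \<comment> \<open>The half-sum is written as zero minus a two-term combination indexed by
    \<open>True\<close> and \<open>False\<close>, to fit
    \<open>derivation_on_linear_combination\<close>.\<close>
  have "derivation_on S (\<lambda>u x. (\<lambda>u x. 0) u x - (\<Sum>i\<in>{True,False}. (if i then - 1 / 2 else - s / 2)
      * frechet_derivative u (at x) (if i then v else w)))"
    by (intro derivation_on_linear_combination derivation_on_frechet Cinf_on_const assms)
      (auto simp: derivation_on_def Cinf_on_const assms)
  then show ?thesis by (simp add: wirtinger_def[abs_def] add_divide_distrib add.commute)
qed

text \<open>By linearity both sides expand into iterated directional derivatives, which agree by
  symmetry of second derivatives.\<close>

lemma wirtinger_commute: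
  assumes "open S" "Cinf_on u S" "x \<in> S"
  shows "wirtinger s v w (wirtinger t a b u) x = wirtinger t a b (wirtinger s v w u) x"
proof -
  have "frechet_derivative (wirtinger s v w u) (at x) c
      = (frechet_derivative (\<lambda>x. frechet_derivative u (at x) v) (at x) c
      + s * frechet_derivative (\<lambda>x. frechet_derivative u (at x) w) (at x) c) / 2" for s v w c
  proof -
    note D = derivation_on_frechet[OF assms(1)]
    have "wirtinger s v w u = (\<lambda>x. 1 / 2 * frechet_derivative u (at x) v + s / 2 * frechet_derivative u (at x) w)"
      by (auto simp: wirtinger_def[abs_def] field_simps)
    moreover have "frechet_derivative (\<lambda>x. 1 / 2 * frechet_derivative u (at x) v + s / 2 * frechet_derivative u (at x) w) (at x) c
      = frechet_derivative (\<lambda>x. 1 / 2 * frechet_derivative u (at x) v) (at x) c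
        + frechet_derivative (\<lambda>x. s / 2 * frechet_derivative u (at x) w) (at x) c"
      by (intro derivation_add[OF D assms(3)] Cinf_on_mult Cinf_on_const Cinf_on_frechet_derivative assms)
    ultimately show ?thesis
      using derivation_cmult[OF D assms(3) Cinf_on_frechet_derivative[OF assms(2)] assms(1)]
      by (simp only: add_divide_distrib) simp
  qed note 1 = this
  have 2: "frechet_derivative (\<lambda>x. frechet_derivative u (at x) c) (at x) d
     = frechet_derivative (\<lambda>x. frechet_derivative u (at x) d) (at x) c" for c d
    by (rule second_derivative_symmetric[OF assms(2,1,3)])
  show ?thesis
    unfolding wirtinger_def[of _ _ _ "wirtinger _ _ _ _"] 1 2[of v] 2[of w] by (simp add: field_simps)
qed

lemma wirtinger_cnj:
  assumes "open S" "Cinf_on u S" "x \<in> S"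
  shows "wirtinger s v w (\<lambda>x. cnj (u x)) x = cnj (wirtinger (cnj s) v w u x)"
  using frechet_derivative_bounded_linear[OF bounded_linear_cnj has_derivative_Cinf_on[OF assms(2,1,3)]]
  by (simp add: wirtinger_def)

lemma wirtinger_linear:
  "bounded_linear u \<Longrightarrow> wirtinger s v w u x = (u v + s * u w) / 2"
  using frechet_derivative_at[OF bounded_linear_imp_has_derivative] by (metis wirtinger_def)

text \<open>The fibre coordinates as functions on \<open>coords\<close>, so that derivations can be
  applied to them.\<close>

definition eta :: "2 \<Rightarrow> coords \<Rightarrow> complex" where
  "eta i x = snd x $ i"

definition etabar :: "2 \<Rightarrow> coords \<Rightarrow> complex" where
  "etabar i x = cnj (snd x $ i)"

lemma bounded_linear_eta: "bounded_linear (eta i)"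
  unfolding eta_def[abs_def]
  by (intro bounded_linear_compose[OF bounded_linear_vec_nth bounded_linear_snd])

lemma bounded_linear_etabar: "bounded_linear (etabar i)"
  using bounded_linear_compose[OF bounded_linear_cnj bounded_linear_eta[of i]]
  by (simp add: eta_def etabar_def[abs_def])

lemma wirtinger_eta:
  "dz k (eta i) x = 0" "dzbar k (eta i) x = 0"
  "deta k (eta i) x = (if i = k then 1 else 0)" "detabar k (eta i) x = 0"
  unfolding dz_wirtinger dzbar_wirtinger deta_wirtinger detabar_wirtinger wirtinger_linear[OF bounded_linear_eta]
  by (auto simp: eta_def axis_def)

lemma wirtinger_etabar:
  "dz k (etabar i) x = 0" "dzbar k (etabar i) x = 0"
  "detabar k (etabar i) x = (if i = k then 1 else 0)" "deta k (etabar i) x = 0"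
  unfolding dz_wirtinger dzbar_wirtinger deta_wirtinger detabar_wirtinger wirtinger_linear[OF bounded_linear_etabar]
  by (auto simp: etabar_def axis_def)

section \<open>The Chern--Finsler connection in one chart\<close>

text \<open>What a complex Finsler metric amounts to in one chart with image \<open>V\<close>. The
  whole curvature computation takes place here; the manifold returns only in the final
  section.\<close>

locale finsler_chart =
  fixes f :: "coords \<Rightarrow> real" and V :: "(complex^2) set"
  assumes open_V: "open V"
    and Cinf_Lfun: "Cinf_on (Lfun f) (V \<times> (UNIV - {0}))"
    and f_pos: "\<And>x. x \<in> V \<times> (UNIV - {0}) \<Longrightarrow> f x > 0"
    and f_scale: "\<And>z \<eta> a. z \<in> V \<Longrightarrow> \<eta> \<noteq> 0 \<Longrightarrow> f (z, a *s \<eta>) = cmod a * f (z, \<eta>)"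
    and pos_def: "\<And>x. x \<in> V \<times> (UNIV - {0}) \<Longrightarrow> hermitian_pos_def (gmat f x)"
begin

abbreviation U :: "coords set" where "U \<equiv> V \<times> (UNIV - {0})"

abbreviation sm :: "(coords \<Rightarrow> complex) \<Rightarrow> bool" where "sm u \<equiv> Cinf_on u U"

definition cL :: "coords \<Rightarrow> complex" where "cL x = complex_of_real (Lfun f x)"

abbreviation Leta :: "2 \<Rightarrow> coords \<Rightarrow> complex" where "Leta i \<equiv> deta i cL"

abbreviation Lbar :: "2 \<Rightarrow> coords \<Rightarrow> complex" where "Lbar i \<equiv> detabar i cL"

lemma open_U: "open U"
  using open_V by (intro open_Times) auto

lemma derivation_on_coords:
  "derivation_on U (dz k)" "derivation_on U (dzbar k)" "derivation_on U (deta k)" "derivation_on U (detabar k)"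
  unfolding dz_wirtinger dzbar_wirtinger deta_wirtinger detabar_wirtinger
  by (rule derivation_on_wirtinger[OF open_U])+

lemmas sm_deriv = derivation_on_coords[THEN derivation_Cinf]

lemma dz_deta: "sm u \<Longrightarrow> x \<in> U \<Longrightarrow> dz j (deta k u) x = deta k (dz j u) x"
  and dz_detabar: "sm u \<Longrightarrow> x \<in> U \<Longrightarrow> dz j (detabar k u) x = detabar k (dz j u) x"
  and dz_dz: "sm u \<Longrightarrow> x \<in> U \<Longrightarrow> dz j (dz k u) x = dz k (dz j u) x"
  and dz_dzbar: "sm u \<Longrightarrow> x \<in> U \<Longrightarrow> dz j (dzbar k u) x = dzbar k (dz j u) x"
  and dzbar_deta: "sm u \<Longrightarrow> x \<in> U \<Longrightarrow> dzbar j (deta k u) x = deta k (dzbar j u) x"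
  and deta_deta: "sm u \<Longrightarrow> x \<in> U \<Longrightarrow> deta j (deta k u) x = deta k (deta j u) x"
  and detabar_deta: "sm u \<Longrightarrow> x \<in> U \<Longrightarrow> detabar j (deta k u) x = deta k (detabar j u) x"
  unfolding dz_wirtinger dzbar_wirtinger deta_wirtinger detabar_wirtinger
  by (rule wirtinger_commute[OF open_U]; assumption)+

lemma sm_cL: "sm cL"
  using Cinf_on_bounded_linear[OF open_U bounded_linear_of_real Cinf_Lfun] by (simp add: cL_def[abs_def])

lemma sm_eta: "sm (eta i)" "sm (etabar i)"
  using open_U by (auto intro: Cinf_on_linear bounded_linear_eta bounded_linear_etabar)

lemma gm_eq: "gm f i j = deta i (Lbar j)"
  by (simp add: gm_def cL_def[abs_def])

lemma sm_gm: "sm (gm f i j)"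
  unfolding gm_eq by (intro sm_deriv sm_cL)

lemma dzbar_cnj: "sm u \<Longrightarrow> x \<in> U \<Longrightarrow> dzbar k (\<lambda>x. cnj (u x)) x = cnj (dz k u x)"
  and detabar_cnj: "sm u \<Longrightarrow> x \<in> U \<Longrightarrow> detabar k (\<lambda>x. cnj (u x)) x = cnj (deta k u x)"
  unfolding dz_wirtinger dzbar_wirtinger deta_wirtinger detabar_wirtinger
  by (simp_all add: wirtinger_cnj[OF open_U])

lemma cnj_cL: "(\<lambda>x. cnj (cL x)) = cL"
  by (simp add: cL_def fun_eq_iff)

lemma Lbar_eq: "x \<in> U \<Longrightarrow> Lbar i x = cnj (Leta i x)"
  using detabar_cnj[OF sm_cL] by (simp add: cnj_cL)

lemma gm_hermitian: "x \<in> U \<Longrightarrow> gm f j i x = cnj (gm f i j x)"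
  using pos_def[THEN hermitian_pos_def_def[THEN iffD1], THEN conjunct1, rule_format, of x j i]
  by (simp only: gmat_def vec_lambda_beta)

section \<open>Euler identities from the homogeneity of L\<close>

lemma frechet_Lfun_radial:
  assumes x: "x \<in> U"
  shows "frechet_derivative (Lfun f) (at x) (0, a *s snd x) = 2 * Re a * Lfun f x"
proof -
  obtain z \<eta> where x_eq: "x = (z, \<eta>)" and z: "z \<in> V" "\<eta> \<noteq> 0" using x by auto
  define d :: coords where "d = (0, a *s \<eta>)"
  have line: "x + t *\<^sub>R d = (z, (1 + of_real t * a) *s \<eta>)" for t
    by (simp add: x_eq d_def vec_eq_iff) (simp add: scaleR_conv_of_real algebra_simps)
  have hd: "(Lfun f has_derivative frechet_derivative (Lfun f) (at x)) (at (x + 0 *\<^sub>R d))"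
    using has_derivative_Cinf_on[OF Cinf_Lfun open_U x] by simp
  have "((\<lambda>t. Lfun f (x + t *\<^sub>R d)) has_derivative (\<lambda>r. frechet_derivative (Lfun f) (at x) (r *\<^sub>R d))) (at 0)"
    by (rule has_derivative_compose[where f = "\<lambda>t. x + t *\<^sub>R d" and g = "Lfun f", OF _ hd])
      (auto intro!: derivative_eq_intros)
  then have "((\<lambda>t. Lfun f (x + t *\<^sub>R d)) has_real_derivative frechet_derivative (Lfun f) (at x) d) (at 0)"
    using linear_cmul[OF has_derivative_linear[OF hd], of _ d]
    by (simp add: has_field_derivative_def mult_commute_abs)
  \<comment> \<open>Homogeneity gives the factor \<open>|1 + t a|^2\<close>, whose derivative at
    \<open>t = 0\<close> is \<open>2 Re a\<close>.\<close>
  moreover have "Lfun f (x + t *\<^sub>R d) = ((1 + t * Re a)\<^sup>2 + (t * Im a)\<^sup>2) * Lfun f x" for t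
    unfolding line Lfun_def f_scale[OF z] by (simp add: x_eq power_mult_distrib cmod_power2)
  then have "((\<lambda>t. Lfun f (x + t *\<^sub>R d)) has_real_derivative 2 * Re a * Lfun f x) (at 0)"
    by (auto intro!: derivative_eq_intros)
  ultimately show ?thesis using DERIV_unique by (fastforce simp: d_def x_eq)
qed

text \<open>Scaling by 1 and by \<i> gives the real derivatives of L along \<eta> and \<i>\<eta>,
  namely 2L and 0. Their Wirtinger combination is the sum in question.\<close>

lemma euler:
  assumes x: "x \<in> U"
  shows "(\<Sum>i\<in>UNIV. Leta i x * eta i x) = cL x"
proof -
  note hd = has_derivative_Cinf_on[OF Cinf_Lfun open_U x]
  define D where "D = frechet_derivative (Lfun f) (at x)"
  have lin: "linear D" using has_derivative_linear[OF hd] by (simp add: D_def)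
  have Leta: "Leta i x = (of_real (D (0, axis i 1)) - \<i> * of_real (D (0, axis i \<i>))) / 2" for i
    using frechet_derivative_bounded_linear[OF bounded_linear_of_real[where 'a = complex] hd]
    by (simp add: deta_def cL_def[abs_def] D_def)
  have split: "(0, v) = (\<Sum>i\<in>UNIV. Re (v $ i) *\<^sub>R (0 :: complex^2, axis i 1) + Im (v $ i) *\<^sub>R (0, axis i \<i>))"
    for v :: "complex^2"
    by (auto simp: sum_2 vec_eq_iff forall_2 axis_def complex_eq_iff)
  have D_eq: "D (0, v) = (\<Sum>i\<in>UNIV. Re (v $ i) * D (0, axis i 1) + Im (v $ i) * D (0, axis i \<i>))" for v
    by (subst split) (simp only: linear_sum[OF lin] linear_add[OF lin] linear_cmul[OF lin] real_scaleR_def)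
  have "D (0, snd x) = 2 * Lfun f x" "D (0, \<i> *s snd x) = 0"
    using frechet_Lfun_radial[OF x, of 1] frechet_Lfun_radial[OF x, of \<i>] by (auto simp: D_def)
  with D_eq[of "snd x"] D_eq[of "\<i> *s snd x"] show ?thesis
    by (simp add: sum_2 Leta cL_def eta_def complex_eq_iff algebra_simps) (simp add: field_simps)
qed

lemma euler_bar: "x \<in> U \<Longrightarrow> (\<Sum>i\<in>UNIV. Lbar i x * etabar i x) = cL x"
  using arg_cong[OF euler, of x cnj] by (simp add: Lbar_eq eta_def etabar_def cL_def)

lemmas D_sum_mult = derivation_sum_mult[OF _ _ open_U finite_class.finite_UNIV]

text \<open>Apply \<open>detabar m\<close> to Euler's identity; it kills \<open>eta\<close>.\<close>

lemma gm_eta: "(\<Sum>i\<in>UNIV. gm f i m x * eta i x) = Lbar m x" if x: "x \<in> U"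
proof -
  have "Lbar m x = detabar m (\<lambda>x. \<Sum>i\<in>UNIV. Leta i x * eta i x) x"
    by (rule derivation_cong[OF derivation_on_coords(4) x]) (simp add: euler)
  also have "\<dots> = (\<Sum>i\<in>UNIV. gm f i m x * eta i x)"
    using x by (subst D_sum_mult[OF derivation_on_coords(4)])
      (auto simp: wirtinger_eta gm_eq detabar_deta sm_cL intro!: sm_deriv sm_eta sm_cL)
  finally show ?thesis ..
qed

lemma gm_etabar: "(\<Sum>m\<in>UNIV. gm f i m x * etabar m x) = Leta i x" if x: "x \<in> U"
proof -
  have "Leta i x = deta i (\<lambda>x. \<Sum>m\<in>UNIV. Lbar m x * etabar m x) x"
    by (rule derivation_cong[OF derivation_on_coords(3) x]) (simp add: euler_bar)
  also have "\<dots> = (\<Sum>m\<in>UNIV. gm f i m x * etabar m x)"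
    using x by (subst D_sum_mult[OF derivation_on_coords(3)])
      (auto simp: wirtinger_etabar gm_eq intro!: sm_deriv sm_eta sm_cL)
  finally show ?thesis ..
qed

text \<open>When \<open>gm_eta\<close> is differentiated in \<eta>, the Kronecker term coming from
  \<open>eta\<close> already equals the derivative of the right-hand side.\<close>

lemma deta_gm_eta: "(\<Sum>i\<in>UNIV. deta k (gm f i m) x * eta i x) = 0" if x: "x \<in> U"
proof -
  have "gm f k m x = deta k (\<lambda>x. \<Sum>i\<in>UNIV. gm f i m x * eta i x) x"
    unfolding gm_eq[of k] by (rule derivation_cong[OF derivation_on_coords(3) x]) (simp add: gm_eta)
  also have "\<dots> = (\<Sum>i\<in>UNIV. deta k (gm f i m) x * eta i x) + gm f k m x"
    using x by (subst D_sum_mult[OF derivation_on_coords(3)])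
      (auto simp: wirtinger_eta sum.distrib if_distrib[of "\<lambda>y. _ * y"] cong: if_cong intro!: sm_gm sm_eta)
  finally show ?thesis by simp
qed

section \<open>The inverse of the metric matrix\<close>

lemma det_gmat: "x \<in> U \<Longrightarrow> gm f 1 1 x * gm f 2 2 x - gm f 1 2 x * gm f 2 1 x \<noteq> 0"
proof
  assume x: "x \<in> U" and 0: "gm f 1 1 x * gm f 2 2 x - gm f 1 2 x * gm f 2 1 x = 0"
  have pd: "Re (\<Sum>i\<in>UNIV. \<Sum>j\<in>UNIV. gm f i j x * v $ i * cnj (v $ j)) > 0" if "v \<noteq> 0" for v
    using pos_def[OF x, THEN hermitian_pos_def_def[THEN iffD1], THEN conjunct2, rule_format, OF that]
    by (simp only: gmat_def vec_lambda_beta)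
  have "gm f 1 1 x \<noteq> 0"
    using pd[of "axis 1 1"] by (auto simp: sum_2 axis_eq_0_iff) (simp add: axis_def)
  \<comment> \<open>Built from the first column of the matrix: if the determinant vanished, this
    nonzero vector would be null for the Hermitian form.\<close>
  define v where "v = (vector [gm f 2 1 x, - gm f 1 1 x] :: complex^2)"
  have v: "v $ 1 = gm f 2 1 x" "v $ 2 = - gm f 1 1 x" by (auto simp: v_def)
  with \<open>gm f 1 1 x \<noteq> 0\<close> have "v \<noteq> 0" by (metis neg_equal_0_iff_equal zero_index)
  have "(\<Sum>i\<in>UNIV. \<Sum>j\<in>UNIV. gm f i j x * v $ i * cnj (v $ j)) =
    - (gm f 1 1 x * gm f 2 2 x - gm f 1 2 x * gm f 2 1 x) * cnj (v $ 2)"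
    by (simp add: sum_2 v algebra_simps)
  with pd[OF \<open>v \<noteq> 0\<close>] 0 show False by simp
qed

text \<open>\<open>matrix_inv\<close> is defined by choice. Uniqueness of inverses identifies it
  with the adjugate divided by the determinant, whose entries are visibly smooth.\<close>

lemma matrix_inv_gmat:
  assumes x: "x \<in> U"
  shows "gmat f x ** matrix_inv (gmat f x) = mat 1" "matrix_inv (gmat f x) ** gmat f x = mat 1"
    and ginv_eq: "ginv f i j x
      = (if i = j then gm f (if i = 1 then 2 else 1) (if i = 1 then 2 else 1) x else - gm f i j x)
        * inverse (gm f 1 1 x * gm f 2 2 x - gm f 1 2 x * gm f 2 1 x)"
proof -
  define d where "d = gm f 1 1 x * gm f 2 2 x - gm f 1 2 x * gm f 2 1 x"
  define B :: "complex^2^2" where "B = (\<chi> i j. (if i = j then gm f (if i = 1 then 2 else 1) (if i = 1 then 2 else 1) x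
    else - gm f i j x) * inverse d)"
  have d: "d \<noteq> 0" using det_gmat[OF x] by (simp add: d_def)
  have B: "gmat f x ** B = mat 1" "B ** gmat f x = mat 1"
    using d by (auto simp: B_def gmat_def matrix_matrix_mult_def mat_def vec_eq_iff forall_2 sum_2 field_simps)
      (simp_all add: d_def algebra_simps)
  have inv: "gmat f x ** matrix_inv (gmat f x) = mat 1 \<and> matrix_inv (gmat f x) ** gmat f x = mat 1"
    unfolding matrix_inv_def by (rule someI[of _ B]) (simp add: B)
  then show "gmat f x ** matrix_inv (gmat f x) = mat 1" "matrix_inv (gmat f x) ** gmat f x = mat 1"
    by auto
  have "matrix_inv (gmat f x) = B"
    using inv B by (metis matrix_mul_assoc matrix_mul_lid matrix_mul_rid)
  then show "ginv f i j x
      = (if i = j then gm f (if i = 1 then 2 else 1) (if i = 1 then 2 else 1) x else - gm f i j x)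
        * inverse (gm f 1 1 x * gm f 2 2 x - gm f 1 2 x * gm f 2 1 x)"
    by (simp add: ginv_def B_def d_def)
qed

lemma gm_ginv: "x \<in> U \<Longrightarrow> (\<Sum>m\<in>UNIV. gm f j m x * ginv f m i x) = (if i = j then 1 else 0)"
  using arg_cong[OF matrix_inv_gmat(1), of x "\<lambda>A. A $ j $ i"]
  by (auto simp: matrix_matrix_mult_def mat_def ginv_def gmat_def)

lemma ginv_gm: "x \<in> U \<Longrightarrow> (\<Sum>i\<in>UNIV. ginv f m i x * gm f i l x) = (if m = l then 1 else 0)"
  using arg_cong[OF matrix_inv_gmat(2), of x "\<lambda>A. A $ m $ l"]
  by (auto simp: matrix_matrix_mult_def mat_def ginv_def gmat_def)

lemma sm_ginv: "sm (ginv f i j)"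
proof -
  have "sm (\<lambda>x. if i = j then gm f (if i = 1 then 2 else 1) (if i = 1 then 2 else 1) x else - gm f i j x)"
    by (cases "i = j") (simp_all add: sm_gm Cinf_on_minus[OF open_U])
  moreover have "sm (\<lambda>x. inverse (gm f 1 1 x * gm f 2 2 x - gm f 1 2 x * gm f 2 1 x))"
    by (intro Cinf_on_mult Cinf_on_inverse Cinf_on_diff open_U sm_gm det_gmat)
  ultimately have "sm (\<lambda>x. (if i = j then gm f (if i = 1 then 2 else 1) (if i = 1 then 2 else 1) x else - gm f i j x)
    * inverse (gm f 1 1 x * gm f 2 2 x - gm f 1 2 x * gm f 2 1 x))"
    by (rule Cinf_on_mult[OF open_U])
  then show ?thesis
    by (rule Cinf_on_cong[OF open_U, THEN iffD2, rotated]) (rule ginv_eq)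
qed

lemma gm_cancel:
  assumes x: "x \<in> U" and eq: "\<And>l. (\<Sum>i\<in>UNIV. a i * gm f i l x) = (\<Sum>i\<in>UNIV. b i * gm f i l x)"
  shows "a i = b i"
proof -
  have "(\<Sum>l\<in>UNIV. (\<Sum>j\<in>UNIV. c j * gm f j l x) * ginv f l i x) = c i" for c
  proof -
    have "(\<Sum>l\<in>UNIV. (\<Sum>j\<in>UNIV. c j * gm f j l x) * ginv f l i x)
      = (\<Sum>j\<in>UNIV. c j * (\<Sum>l\<in>UNIV. gm f j l x * ginv f l i x))"
      by (simp add: sum_2 algebra_simps)
    also have "\<dots> = c i" unfolding gm_ginv[OF x] by (simp add: if_distrib cong: if_cong)
    finally show ?thesis .
  qed
  from this[of a] this[of b] show ?thesis unfolding eq by (rule trans[OF sym])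
qed

section \<open>Horizontal derivations and the functions they annihilate\<close>

lemma sm_Nc: "sm (Nc f k j)"
  unfolding Nc_def[abs_def] eta_def[symmetric]
  by (intro Cinf_on_sum Cinf_on_mult open_U sm_ginv sm_deriv sm_gm sm_eta)

lemma derivation_on_hdel: "derivation_on U (hdel f k)"
  unfolding hdel_def[abs_def]
  by (intro derivation_on_linear_combination derivation_on_coords open_U sm_Nc) simp

lemma derivation_on_hdelbar: "derivation_on U (hdelbar f k)"
  unfolding hdelbar_def[abs_def]
  by (intro derivation_on_linear_combination derivation_on_coords open_U sm_Nc Cinf_on_cnj) simp

lemmas sm_hdel = derivation_Cinf[OF derivation_on_hdel] derivation_Cinf[OF derivation_on_hdelbar]

lemma sm_Lc: "sm (Lc f i j k)" and sm_Cc: "sm (Cc f i j k)"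
  unfolding Lc_def[abs_def] Cc_def[abs_def]
  by (intro Cinf_on_sum Cinf_on_mult open_U sm_ginv sm_deriv sm_gm sm_hdel)+

text \<open>The horizontal field of type (0,1) along the conjugate of \<eta>. It is the operator in
  the definition of \<open>Kinv\<close>, and both contracted curvatures are expressed through
  it.\<close>

definition Sb :: "(coords \<Rightarrow> complex) \<Rightarrow> coords \<Rightarrow> complex" where
  "Sb u x = (\<Sum>h\<in>UNIV. etabar h x * hdelbar f h u x)"

lemma derivation_on_Sb: "derivation_on U Sb"
proof -
  have "derivation_on U (\<lambda>u x. (\<lambda>u x. 0) u x - (\<Sum>h\<in>UNIV. (- etabar h x) * hdelbar f h u x))"
    by (intro derivation_on_linear_combination derivation_on_hdelbar Cinf_on_minus sm_eta open_U)
      (auto simp: derivation_on_def Cinf_on_const open_U)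
  then show ?thesis by (simp add: Sb_def[abs_def] sum_negf)
qed

text \<open>Lowering the index of N cancels \<open>ginv\<close>, and \<open>gm_eta\<close> turns the
  remaining contraction into \<open>Lbar\<close>. Read as \<open>hdel_Lbar\<close>, it says that
  horizontal derivatives kill \<open>Lbar\<close>.\<close>

lemma Nc_gm:
  assumes x: "x \<in> U"
  shows "(\<Sum>k\<in>UNIV. Nc f k j x * gm f k r x) = dz j (Lbar r) x"
proof -
  have "(\<Sum>k\<in>UNIV. Nc f k j x * gm f k r x) =
      (\<Sum>m\<in>UNIV. (\<Sum>k\<in>UNIV. ginv f m k x * gm f k r x) * (\<Sum>l\<in>UNIV. dz j (gm f l m) x * eta l x))"
    by (simp add: Nc_def eta_def sum_2 algebra_simps)
  also have "\<dots> = (\<Sum>l\<in>UNIV. dz j (gm f l r) x * eta l x)"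
    unfolding ginv_gm[OF x] by (simp add: if_distrib[of "\<lambda>y. y * _"] cong: if_cong)
  also have "\<dots> = dz j (\<lambda>x. \<Sum>l\<in>UNIV. gm f l r x * eta l x) x"
    using x by (subst D_sum_mult[OF derivation_on_coords(1)]) (auto simp: wirtinger_eta intro!: sm_gm sm_eta)
  also have "\<dots> = dz j (Lbar r) x"
    by (rule derivation_cong[OF derivation_on_coords(1) x]) (simp add: gm_eta)
  finally show ?thesis .
qed

lemma hdel_Lbar: "x \<in> U \<Longrightarrow> hdel f j (Lbar m) x = 0"
  using Nc_gm by (simp add: hdel_def gm_eq)

lemma hdel_eta: "hdel f j (eta k) x = - Nc f k j x" "hdel f j (etabar k) x = 0"
  by (simp_all add: hdel_def wirtinger_eta wirtinger_etabar if_distrib cong: if_cong)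

lemma hdelbar_eta: "hdelbar f j (eta k) x = 0" "hdelbar f j (etabar k) x = - cnj (Nc f k j x)"
  by (simp_all add: hdelbar_def wirtinger_eta wirtinger_etabar if_distrib cong: if_cong)

text \<open>By Euler, L is the sum of the products of \<open>Lbar m\<close> and
  \<open>etabar m\<close>, and \<open>hdel\<close> kills both factors.\<close>

lemma hdel_cL: "x \<in> U \<Longrightarrow> hdel f j cL x = 0"
proof -
  assume x: "x \<in> U"
  have "hdel f j cL x = hdel f j (\<lambda>x. \<Sum>m\<in>UNIV. Lbar m x * etabar m x) x"
    by (rule derivation_cong[OF derivation_on_hdel x]) (simp add: euler_bar)
  also have "\<dots> = 0"
    using x by (subst D_sum_mult[OF derivation_on_hdel])
      (auto simp: hdel_eta hdel_Lbar intro!: sm_deriv sm_cL sm_eta)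
  finally show ?thesis .
qed

lemma hdelbar_cnj: "sm u \<Longrightarrow> x \<in> U \<Longrightarrow> hdelbar f k (\<lambda>x. cnj (u x)) x = cnj (hdel f k u x)"
  by (simp add: hdelbar_def hdel_def dzbar_cnj detabar_cnj)

lemma hdelbar_cL: "x \<in> U \<Longrightarrow> hdelbar f j cL x = 0"
  using hdelbar_cnj[OF sm_cL] by (simp add: cnj_cL hdel_cL)

lemma hdelbar_Leta: "x \<in> U \<Longrightarrow> hdelbar f j (Leta m) x = 0"
proof -
  assume x: "x \<in> U"
  have "hdelbar f j (Leta m) x = hdelbar f j (\<lambda>x. cnj (Lbar m x)) x"
    by (rule derivation_cong[OF derivation_on_hdelbar x]) (simp add: Lbar_eq)
  then show ?thesis using hdelbar_cnj[OF sm_deriv(4)[OF sm_cL] x] hdel_Lbar[OF x] by simp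
qed

lemma Nc_Leta: "x \<in> U \<Longrightarrow> (\<Sum>k\<in>UNIV. Nc f k j x * Leta k x) = dz j cL x"
  using hdel_cL[of x j] by (simp add: hdel_def)

text \<open>The coordinate fields commute, so all second-order terms cancel and only derivatives of
  the coefficients N remain: the commutator is vertical.\<close>

lemma hdel_commutator:
  assumes u: "sm u" and x: "x \<in> U"
  shows "hdel f j (hdel f k u) x - hdel f k (hdel f j u) x
    = - (\<Sum>l\<in>UNIV. (hdel f j (Nc f l k) x - hdel f k (Nc f l j) x) * deta l u x)"
proof -
  have "hdel f j (hdel f k u) x = hdel f j (dz k u) x
      - (\<Sum>l\<in>UNIV. hdel f j (Nc f l k) x * deta l u x + Nc f l k x * hdel f j (deta l u) x)" for j k
  proof -
    have "hdel f k u = (\<lambda>x. dz k u x - (\<Sum>l\<in>UNIV. Nc f l k x * deta l u x))"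
      by (simp add: hdel_def fun_eq_iff)
    then have "hdel f j (hdel f k u) x = hdel f j (\<lambda>x. dz k u x - (\<Sum>l\<in>UNIV. Nc f l k x * deta l u x)) x"
      by (rule arg_cong)
    then show ?thesis
      using D_sum_mult[OF derivation_on_hdel x, where u = "\<lambda>l. Nc f l k" and v = "\<lambda>l. deta l u"]
      by (subst (asm) derivation_diff[OF derivation_on_hdel x open_U])
        (auto intro!: Cinf_on_sum Cinf_on_mult open_U sm_Nc sm_deriv u)
  qed
  then show ?thesis
    using dz_dz[OF u x, of j k] dz_deta[OF u x] deta_deta[OF u x, of 1 2]
    by (simp only:) (simp add: hdel_def sum_2 algebra_simps)
qed

text \<open>Test the vertical commutator on \<open>Lbar m\<close>, which horizontal derivatives
  kill. Its coefficients contracted with the metric vanish, hence so do the coefficients.\<close>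

lemma hdel_hdel:
  assumes u: "sm u" and x: "x \<in> U"
  shows "hdel f j (hdel f k u) x = hdel f k (hdel f j u) x"
proof -
  have 0: "hdel f j (hdel f k (Lbar m)) x = 0" for j k m
    using derivation_cong[OF derivation_on_hdel x, of "hdel f k (Lbar m)" "\<lambda>_. 0"]
      derivation_const[OF derivation_on_hdel x] hdel_Lbar by simp
  have "(\<Sum>l\<in>UNIV. (hdel f j (Nc f l k) x - hdel f k (Nc f l j) x) * gm f l m x)
      = (\<Sum>l\<in>UNIV. 0 * gm f l m x)" for m
    using hdel_commutator[OF sm_deriv(4)[OF sm_cL] x, of j k m] by (simp add: 0 gm_eq)
  from gm_cancel[OF x this] have "hdel f j (Nc f l k) x - hdel f k (Nc f l j) x = 0" for l .
  with hdel_commutator[OF u x, of j k] show ?thesis by simp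
qed

section \<open>Contractions of the connection and curvature coefficients\<close>

lemma gm_Lc:
  assumes x: "x \<in> U"
  shows "(\<Sum>i\<in>UNIV. gm f i l x * Lc f i j k x) = hdel f k (gm f j l) x"
proof -
  have "(\<Sum>i\<in>UNIV. gm f i l x * Lc f i j k x)
      = (\<Sum>m\<in>UNIV. (\<Sum>i\<in>UNIV. ginv f m i x * gm f i l x) * hdel f k (gm f j m) x)"
    by (simp add: Lc_def sum_2 algebra_simps)
  then show ?thesis unfolding ginv_gm[OF x] by (simp add: if_distrib[of "\<lambda>y. y * _"] cong: if_cong)
qed

lemma gm_Cc:
  assumes x: "x \<in> U"
  shows "(\<Sum>i\<in>UNIV. gm f i l x * Cc f i j k x) = deta k (gm f j l) x"
proof -
  have "(\<Sum>i\<in>UNIV. gm f i l x * Cc f i j k x)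
      = (\<Sum>m\<in>UNIV. (\<Sum>i\<in>UNIV. ginv f m i x * gm f i l x) * deta k (gm f j m) x)"
    by (simp add: Cc_def sum_2 algebra_simps)
  then show ?thesis unfolding ginv_gm[OF x] by (simp add: if_distrib[of "\<lambda>y. y * _"] cong: if_cong)
qed

text \<open>Stated for any derivation that kills \<open>etabar\<close>, because it serves both
  \<open>hdel\<close> (for \<open>Leta_Lc\<close>) and \<open>deta\<close> (for
  \<open>Leta_Cc\<close>).\<close>

lemma derivation_gm_etabar:
  assumes D: "derivation_on U D" and x: "x \<in> U" and 0: "\<And>l. D (etabar l) x = 0"
  shows "(\<Sum>l\<in>UNIV. D (gm f i l) x * etabar l x) = D (Leta i) x"
proof -
  have "D (Leta i) x = D (\<lambda>x. \<Sum>l\<in>UNIV. gm f i l x * etabar l x) x"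
    by (rule derivation_cong[OF D x]) (simp add: gm_etabar)
  also have "\<dots> = (\<Sum>l\<in>UNIV. D (gm f i l) x * etabar l x)"
    using x by (subst D_sum_mult[OF D]) (auto simp: 0 intro!: sm_gm sm_eta)
  finally show ?thesis ..
qed

lemma Leta_Lc:
  assumes x: "x \<in> U"
  shows "(\<Sum>i\<in>UNIV. Leta i x * Lc f i j k x) = hdel f k (Leta j) x"
proof -
  have "(\<Sum>i\<in>UNIV. Leta i x * Lc f i j k x) = (\<Sum>l\<in>UNIV. (\<Sum>i\<in>UNIV. gm f i l x * Lc f i j k x) * etabar l x)"
    unfolding gm_etabar[OF x, symmetric] by (simp add: sum_2 algebra_simps)
  then show ?thesis
    unfolding gm_Lc[OF x] using derivation_gm_etabar[OF derivation_on_hdel x hdel_eta(2)] by simp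
qed

lemma Leta_Cc:
  assumes x: "x \<in> U"
  shows "(\<Sum>i\<in>UNIV. Leta i x * Cc f i j k x) = deta k (Leta j) x"
proof -
  have "(\<Sum>i\<in>UNIV. Leta i x * Cc f i j k x) = (\<Sum>l\<in>UNIV. (\<Sum>i\<in>UNIV. gm f i l x * Cc f i j k x) * etabar l x)"
    unfolding gm_etabar[OF x, symmetric] by (simp add: sum_2 algebra_simps)
  then show ?thesis
    unfolding gm_Cc[OF x] using derivation_gm_etabar[OF derivation_on_coords(3) x wirtinger_etabar(4)] by simp
qed

text \<open>Differentiate \<open>gm_eta\<close> horizontally: the right-hand side is killed, and the
  derivative of \<open>eta\<close> contributes -N. Cancelling the metric leaves the
  identity.\<close>

lemma Lc_eta:
  assumes x: "x \<in> U"
  shows "(\<Sum>j\<in>UNIV. Lc f i j k x * eta j x) = Nc f i k x"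
proof (rule gm_cancel[OF x, of "\<lambda>i. \<Sum>j\<in>UNIV. Lc f i j k x * eta j x" "\<lambda>i. Nc f i k x"])
  fix l
  have "0 = hdel f k (\<lambda>x. \<Sum>j\<in>UNIV. gm f j l x * eta j x) x"
    using derivation_cong[OF derivation_on_hdel x, of "\<lambda>x. \<Sum>j\<in>UNIV. gm f j l x * eta j x" "Lbar l"]
    by (simp add: gm_eta hdel_Lbar x)
  also have "\<dots> = (\<Sum>j\<in>UNIV. hdel f k (gm f j l) x * eta j x) - (\<Sum>j\<in>UNIV. Nc f j k x * gm f j l x)"
    using x by (subst D_sum_mult[OF derivation_on_hdel])
      (auto simp: hdel_eta sum_2 algebra_simps intro!: sm_gm sm_eta)
  finally have "(\<Sum>j\<in>UNIV. hdel f k (gm f j l) x * eta j x) = (\<Sum>j\<in>UNIV. Nc f j k x * gm f j l x)" by simp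
  moreover have "(\<Sum>i\<in>UNIV. (\<Sum>j\<in>UNIV. Lc f i j k x * eta j x) * gm f i l x)
      = (\<Sum>j\<in>UNIV. (\<Sum>i\<in>UNIV. gm f i l x * Lc f i j k x) * eta j x)"
    by (simp add: sum_2 algebra_simps)
  ultimately show "(\<Sum>i\<in>UNIV. (\<Sum>j\<in>UNIV. Lc f i j k x * eta j x) * gm f i l x)
      = (\<Sum>i\<in>UNIV. Nc f i k x * gm f i l x)"
    by (simp add: gm_Lc[OF x])
qed

lemma Cc_eta:
  assumes x: "x \<in> U"
  shows "(\<Sum>j\<in>UNIV. Cc f i j k x * eta j x) = 0"
proof -
  have "(\<Sum>j\<in>UNIV. Cc f i j k x * eta j x) = (\<Sum>m\<in>UNIV. ginv f m i x * (\<Sum>j\<in>UNIV. deta k (gm f j m) x * eta j x))"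
    by (simp add: Cc_def sum_2 algebra_simps)
  then show ?thesis by (simp add: deta_gm_eta[OF x])
qed

text \<open>\<open>hdelbar\<close> annihilates \<open>Leta\<close>, so this factor can be moved
  under the derivative.\<close>

lemma hdelbar_sum_Leta:
  assumes x: "x \<in> U" and Z: "\<And>i. sm (Z i)"
  shows "(\<Sum>i\<in>UNIV. Leta i x * hdelbar f h (Z i) x) = hdelbar f h (\<lambda>x. \<Sum>i\<in>UNIV. Leta i x * Z i x) x"
  using x by (subst D_sum_mult[OF derivation_on_hdelbar]) (auto simp: hdelbar_Leta intro!: Z sm_deriv sm_cL)

lemma hdelbar_sum_eta:
  assumes x: "x \<in> U" and Z: "\<And>i. sm (Z i)"
  shows "(\<Sum>i\<in>UNIV. hdelbar f h (Z i) x * eta i x) = hdelbar f h (\<lambda>x. \<Sum>i\<in>UNIV. Z i x * eta i x) x"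
  using x by (subst D_sum_mult[OF derivation_on_hdelbar]) (auto simp: hdelbar_eta intro!: Z sm_eta)

lemma Rup_eta3:
  assumes x: "x \<in> U"
  shows "(\<Sum>j\<in>UNIV. Rup f i j h k x * eta j x) = - hdelbar f h (Nc f i k) x"
proof -
  have "(\<Sum>j\<in>UNIV. Rup f i j h k x * eta j x)
      = - (\<Sum>j\<in>UNIV. hdelbar f h (Lc f i j k) x * eta j x)
        - (\<Sum>l\<in>UNIV. hdelbar f h (Nc f l k) x * (\<Sum>j\<in>UNIV. Cc f i j l x * eta j x))"
    by (simp add: Rup_def sum_2 algebra_simps)
  then show ?thesis
    unfolding hdelbar_sum_eta[OF x sm_Lc] Cc_eta[OF x]
    using derivation_cong[OF derivation_on_hdelbar x Lc_eta] by simp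
qed

text \<open>Contracting the first lower index with \<eta> removes the C term
  (\<open>Rup_eta3\<close>). The metric and \<open>etabar\<close> combine to \<open>Leta\<close>,
  which passes under \<open>hdelbar\<close> and meets N in \<open>Nc_Leta\<close>.\<close>

lemma R_000k_eq:
  assumes x: "x \<in> U"
  shows "R_000k f k x = - Sb (dz k cL) x"
proof -
  have "R_000k f k x = (\<Sum>h\<in>UNIV. etabar h x * (\<Sum>i\<in>UNIV. (\<Sum>r\<in>UNIV. gm f i r x * etabar r x)
      * (\<Sum>j\<in>UNIV. Rup f i j h k x * eta j x)))"
    by (simp add: R_000k_def Rlow_def eta_def etabar_def sum_2 algebra_simps)
  also have "\<dots> = - (\<Sum>h\<in>UNIV. etabar h x * (\<Sum>i\<in>UNIV. Leta i x * hdelbar f h (Nc f i k) x))"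
    unfolding Rup_eta3[OF x] gm_etabar[OF x] by (simp add: sum_negf)
  also have "\<dots> = - Sb (dz k cL) x"
    unfolding hdelbar_sum_Leta[OF x sm_Nc] Sb_def
    using derivation_cong[OF derivation_on_hdelbar x, of "\<lambda>x. \<Sum>i\<in>UNIV. Leta i x * Nc f i k x" "dz k cL"] Nc_Leta
    by (simp add: mult.commute)
  finally show ?thesis .
qed

subsection \<open>Curvature and torsion\<close>

text \<open>Up to sign, the vertical coefficients of the horizontal field along \<eta>;
  \<open>spray_bar\<close> holds those of the conjugate field.\<close>

definition spray :: "2 \<Rightarrow> coords \<Rightarrow> complex" where
  "spray i x = (\<Sum>j\<in>UNIV. Nc f i j x * eta j x)"

definition spray_bar :: "2 \<Rightarrow> coords \<Rightarrow> complex" where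
  "spray_bar i x = (\<Sum>j\<in>UNIV. cnj (Nc f i j x) * etabar j x)"

text \<open>This is F^3 times the function J, as the proof of \<open>Sb_dL0\<close> shows.\<close>

definition dL0 :: "coords \<Rightarrow> complex" where
  "dL0 x = (\<Sum>j\<in>UNIV. dz j cL x * eta j x)"

text \<open>This is the function \<open>u\<close> of the introduction.\<close>

definition dL0bar :: "coords \<Rightarrow> complex" where
  "dL0bar x = (\<Sum>j\<in>UNIV. dzbar j cL x * etabar j x)"

lemma sm_spray: "sm (spray i)" and sm_spray_bar: "sm (spray_bar i)" and sm_dL0: "sm dL0" and sm_dL0bar: "sm dL0bar"
  unfolding spray_def[abs_def] spray_bar_def[abs_def] dL0_def[abs_def] dL0bar_def[abs_def]
  by (intro Cinf_on_sum Cinf_on_mult Cinf_on_cnj open_U sm_Nc sm_eta sm_deriv sm_cL)+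

lemma Sb_eq: "Sb v x = (\<Sum>h\<in>UNIV. dzbar h v x * etabar h x) - (\<Sum>j\<in>UNIV. spray_bar j x * detabar j v x)"
  by (simp add: Sb_def hdelbar_def spray_bar_def sum_2 algebra_simps)

lemma Sb_cL: "x \<in> U \<Longrightarrow> Sb cL x = 0" and Sb_Leta: "x \<in> U \<Longrightarrow> Sb (Leta i) x = 0"
  by (simp_all add: Sb_def hdelbar_cL hdelbar_Leta)

text \<open>\<open>deta k\<close> commutes with the conjugate coordinate derivatives and kills
  \<open>etabar\<close>, so its commutator with \<open>Sb\<close> comes only from the coefficients
  \<open>spray_bar\<close>.\<close>

lemma deta_Sb:
  assumes v: "sm v" and x: "x \<in> U"
  shows "deta k (Sb v) x = Sb (deta k v) x - (\<Sum>j\<in>UNIV. deta k (spray_bar j) x * detabar j v x)"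
proof -
  have "deta k (Sb v) x = deta k (\<lambda>x. (\<Sum>h\<in>UNIV. dzbar h v x * etabar h x) - (\<Sum>j\<in>UNIV. spray_bar j x * detabar j v x)) x"
    unfolding Sb_eq[abs_def] ..
  also have "\<dots> = (\<Sum>h\<in>UNIV. deta k (dzbar h v) x * etabar h x)
      - (\<Sum>j\<in>UNIV. deta k (spray_bar j) x * detabar j v x + spray_bar j x * deta k (detabar j v) x)"
    using x by (subst derivation_diff[OF derivation_on_coords(3) x open_U], (auto intro!: Cinf_on_sum Cinf_on_mult open_U sm_deriv v sm_eta sm_spray_bar)[2])
      (subst (1 2) D_sum_mult[OF derivation_on_coords(3)], auto simp: wirtinger_etabar intro!: sm_deriv v sm_eta sm_spray_bar)
  also have "\<dots> = Sb (deta k v) x - (\<Sum>j\<in>UNIV. deta k (spray_bar j) x * detabar j v x)"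
    using dzbar_deta[OF v x] detabar_deta[OF v x] by (simp add: Sb_eq sum.distrib)
  finally show ?thesis .
qed

lemma Nc_bar_gm:
  assumes x: "x \<in> U"
  shows "(\<Sum>j\<in>UNIV. gm f i j x * cnj (Nc f j h x)) = dzbar h (Leta i) x"
proof -
  have "dzbar h (Leta i) x = dzbar h (\<lambda>x. cnj (Lbar i x)) x"
    by (rule derivation_cong[OF derivation_on_coords(2) x]) (simp add: Lbar_eq)
  also have "\<dots> = cnj (\<Sum>j\<in>UNIV. Nc f j h x * gm f j i x)"
    unfolding Nc_gm[OF x] by (rule dzbar_cnj[OF sm_deriv(4)[OF sm_cL] x])
  also have "\<dots> = (\<Sum>j\<in>UNIV. gm f i j x * cnj (Nc f j h x))"
    using gm_hermitian[OF x, of i] by (simp add: mult.commute)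
  finally show ?thesis ..
qed

text \<open>Both sides equal the mixed second z-derivative of L contracted with
  \<open>etabar\<close>, minus N and \<open>spray_bar\<close> paired by the metric. Together with
  \<open>R_000k_eq\<close> this is the first formula of the introduction.\<close>

lemma Sb_dz_cL:
  assumes x: "x \<in> U"
  shows "Sb (dz k cL) x = hdel f k dL0bar x"
proof -
  have "hdel f k dL0bar x = (\<Sum>h\<in>UNIV. hdel f k (dzbar h cL) x * etabar h x)"
    unfolding dL0bar_def[abs_def] using x
    by (subst D_sum_mult[OF derivation_on_hdel]) (auto simp: hdel_eta intro!: sm_deriv sm_cL sm_eta)
  also have "\<dots> = (\<Sum>h\<in>UNIV. dz k (dzbar h cL) x * etabar h x)
      - (\<Sum>h\<in>UNIV. (\<Sum>i\<in>UNIV. Nc f i k x * dzbar h (Leta i) x) * etabar h x)"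
    using dzbar_deta[OF sm_cL x] by (simp add: hdel_def left_diff_distrib sum_subtractf)
  also have "(\<Sum>h\<in>UNIV. (\<Sum>i\<in>UNIV. Nc f i k x * dzbar h (Leta i) x) * etabar h x)
      = (\<Sum>j\<in>UNIV. spray_bar j x * (\<Sum>i\<in>UNIV. Nc f i k x * gm f i j x))"
    unfolding Nc_bar_gm[OF x, symmetric] by (simp add: spray_bar_def sum_2 algebra_simps)
  finally show ?thesis
    unfolding Nc_gm[OF x] using dz_dzbar[OF sm_cL x] dz_detabar[OF sm_cL x] by (simp add: Sb_eq)
qed

lemma detabar_dL0:
  assumes x: "x \<in> U"
  shows "detabar j dL0 x = (\<Sum>i\<in>UNIV. spray i x * gm f i j x)"
proof -
  have "detabar j dL0 x = (\<Sum>l\<in>UNIV. dz l (Lbar j) x * eta l x)"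
    unfolding dL0_def[abs_def] using x dz_detabar[OF sm_cL x]
    by (subst D_sum_mult[OF derivation_on_coords(4)]) (auto simp: wirtinger_eta intro!: sm_deriv sm_cL sm_eta)
  then show ?thesis
    unfolding Nc_gm[OF x, symmetric] by (simp add: spray_def sum_2 algebra_simps)
qed

text \<open>Replacing \<open>dz j\<close> by \<open>hdel f j\<close> costs a \<open>spray\<close>
  term. The splitting is chosen so that applying \<open>Sb\<close> exhibits both contracted
  curvatures.\<close>

lemma deta_dL0:
  assumes x: "x \<in> U"
  shows "deta k dL0 x = (\<Sum>j\<in>UNIV. hdel f j (Leta k) x * eta j x) + dz k cL x
    + (\<Sum>l\<in>UNIV. spray l x * deta l (Leta k) x)"
proof -
  have "deta k dL0 x = (\<Sum>j\<in>UNIV. dz j (Leta k) x * eta j x) + dz k cL x"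
    unfolding dL0_def[abs_def] using x dz_deta[OF sm_cL x]
    by (subst D_sum_mult[OF derivation_on_coords(3)])
      (auto simp: wirtinger_eta sum.distrib if_distrib[of "\<lambda>y. _ * y"] cong: if_cong intro!: sm_deriv sm_cL sm_eta)
  then show ?thesis by (simp add: hdel_def spray_def sum_2 algebra_simps)
qed

text \<open>Apply \<open>deta_Sb\<close> to \<open>Leta l\<close>, which \<open>Sb\<close>
  annihilates, and exchange the two vertical derivatives of L.\<close>

lemma Sb_deta_Leta:
  assumes x: "x \<in> U"
  shows "Sb (deta l (Leta k)) x = (\<Sum>j\<in>UNIV. deta k (spray_bar j) x * gm f l j x)"
proof -
  have "0 = deta k (Sb (Leta l)) x"
    using derivation_cong[OF derivation_on_coords(3) x, of "Sb (Leta l)" "\<lambda>_. 0"]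
      derivation_const[OF derivation_on_coords(3) x] Sb_Leta by simp
  also have "\<dots> = Sb (deta k (Leta l)) x - (\<Sum>j\<in>UNIV. deta k (spray_bar j) x * gm f l j x)"
    using detabar_deta[OF sm_cL x] by (simp add: deta_Sb sm_deriv sm_cL x gm_eq)
  also have "Sb (deta k (Leta l)) x = Sb (deta l (Leta k)) x"
    by (rule derivation_cong[OF derivation_on_Sb x]) (rule deta_deta[OF sm_cL])
  finally show ?thesis by simp
qed

text \<open>Here \<eta> meets the last index, so neither \<open>Lc_eta\<close> nor
  \<open>Cc_eta\<close> applies and a second vertical derivative of L survives. The factor
  \<open>Leta\<close> can still be moved under \<open>hdelbar\<close>.\<close>

lemma R_0k00_eq:
  assumes x: "x \<in> U"
  shows "R_0k00 f k x = - Sb (\<lambda>x. \<Sum>j\<in>UNIV. hdel f j (Leta k) x * eta j x) x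
    - (\<Sum>l\<in>UNIV. Sb (spray l) x * deta l (Leta k) x)"
proof -
  define Z where "Z i x = (\<Sum>j\<in>UNIV. Lc f i k j x * eta j x)" for i x
  have sm_Z: "sm (Z i)" for i
    unfolding Z_def[abs_def] by (intro Cinf_on_sum Cinf_on_mult open_U sm_Lc sm_eta)
  have R: "(\<Sum>j\<in>UNIV. Rup f i k h j x * eta j x)
      = - hdelbar f h (Z i) x - (\<Sum>l\<in>UNIV. hdelbar f h (spray l) x * Cc f i k l x)" for i h
  proof -
    have "(\<Sum>j\<in>UNIV. Rup f i k h j x * eta j x)
      = - (\<Sum>j\<in>UNIV. hdelbar f h (Lc f i k j) x * eta j x)
        - (\<Sum>l\<in>UNIV. (\<Sum>j\<in>UNIV. hdelbar f h (Nc f l j) x * eta j x) * Cc f i k l x)"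
      by (simp add: Rup_def sum_2 algebra_simps)
    then show ?thesis
      unfolding hdelbar_sum_eta[OF x sm_Lc] hdelbar_sum_eta[OF x sm_Nc]
      by (simp only: Z_def[abs_def] spray_def[abs_def])
  qed
  have Z: "(\<Sum>i\<in>UNIV. Leta i x * hdelbar f h (Z i) x)
      = hdelbar f h (\<lambda>x. \<Sum>j\<in>UNIV. hdel f j (Leta k) x * eta j x) x" for h
    unfolding hdelbar_sum_Leta[OF x sm_Z]
  proof (rule derivation_cong[OF derivation_on_hdelbar x])
    fix y assume y: "y \<in> U"
    have "(\<Sum>i\<in>UNIV. Leta i y * Z i y) = (\<Sum>j\<in>UNIV. (\<Sum>i\<in>UNIV. Leta i y * Lc f i k j y) * eta j y)"
      by (simp add: Z_def sum_2 algebra_simps)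
    then show "(\<Sum>i\<in>UNIV. Leta i y * Z i y) = (\<Sum>j\<in>UNIV. hdel f j (Leta k) y * eta j y)"
      unfolding Leta_Lc[OF y] .
  qed
  have "R_0k00 f k x = (\<Sum>h\<in>UNIV. etabar h x * (\<Sum>i\<in>UNIV. (\<Sum>r\<in>UNIV. gm f i r x * etabar r x)
      * (\<Sum>j\<in>UNIV. Rup f i k h j x * eta j x)))"
    by (simp add: R_0k00_def Rlow_def eta_def etabar_def sum_2 algebra_simps)
  also have "\<dots> = - (\<Sum>h\<in>UNIV. etabar h x * (\<Sum>i\<in>UNIV. Leta i x * hdelbar f h (Z i) x))
      - (\<Sum>l\<in>UNIV. Sb (spray l) x * (\<Sum>i\<in>UNIV. Leta i x * Cc f i k l x))"
    unfolding R gm_etabar[OF x] by (simp add: Sb_def sum_2 algebra_simps)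
  finally show ?thesis unfolding Z Leta_Cc[OF x] by (simp add: Sb_def)
qed

text \<open>Apply \<open>Sb\<close> to \<open>deta_dL0\<close>. Besides minus the two curvatures
  this leaves \<open>spray\<close> times \<open>Sb\<close> of second derivatives, which is exactly
  the correction term of \<open>deta_Sb\<close> for \<open>dL0\<close>.\<close>

lemma R_0k00_add_R_000k:
  assumes x: "x \<in> U"
  shows "R_0k00 f k x + R_000k f k x = - deta k (Sb dL0) x"
proof -
  define Y where "Y x = (\<Sum>j\<in>UNIV. hdel f j (Leta k) x * eta j x)" for x
  have sm_Y: "sm Y"
    unfolding Y_def[abs_def] by (intro Cinf_on_sum Cinf_on_mult open_U sm_hdel sm_deriv sm_cL sm_eta)
  have sm_rest: "sm (\<lambda>x. \<Sum>l\<in>UNIV. spray l x * deta l (Leta k) x)"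
    by (intro Cinf_on_sum Cinf_on_mult open_U sm_deriv sm_cL sm_spray)
  have "Sb (deta k dL0) x = Sb (\<lambda>x. (Y x + dz k cL x) + (\<Sum>l\<in>UNIV. spray l x * deta l (Leta k) x)) x"
    by (rule derivation_cong[OF derivation_on_Sb x]) (simp add: deta_dL0 Y_def)
  also have "\<dots> = Sb Y x + Sb (dz k cL) x
      + (\<Sum>l\<in>UNIV. Sb (spray l) x * deta l (Leta k) x + spray l x * Sb (deta l (Leta k)) x)"
    by (simp add: derivation_add[OF derivation_on_Sb x] D_sum_mult[OF derivation_on_Sb x]
        Cinf_on_add open_U sm_Y sm_rest sm_deriv sm_cL sm_spray)
  finally have Sb_deta_dL0: "Sb (deta k dL0) x = \<dots>" .
  have "(\<Sum>l\<in>UNIV. spray l x * Sb (deta l (Leta k)) x) = (\<Sum>j\<in>UNIV. deta k (spray_bar j) x * detabar j dL0 x)"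
    unfolding Sb_deta_Leta[OF x] detabar_dL0[OF x] by (simp add: sum_2 algebra_simps)
  then show ?thesis
    unfolding R_0k00_eq[OF x] R_000k_eq[OF x] deta_Sb[OF sm_dL0 x] Sb_deta_dL0
    by (simp add: Y_def[abs_def] sum.distrib)
qed

section \<open>The invariant K, the torsion and the conclusion in one chart\<close>

definition cF :: "coords \<Rightarrow> complex" where "cF x = complex_of_real (f x)"

lemma sm_cF: "sm cF"
proof -
  have "Cinf_on (\<lambda>x. sqrt (Lfun f x)) U"
    unfolding Cinf_on_def
  proof (intro allI Cn_on_sqrt[OF open_U])
    show "Cn_on n (Lfun f) U" for n using Cinf_Lfun by (simp add: Cinf_on_def)
    show "Lfun f x > 0" if "x \<in> U" for x using f_pos[OF that] by (simp add: Lfun_def)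
  qed
  then have "sm (\<lambda>x. complex_of_real (sqrt (Lfun f x)))"
    by (rule Cinf_on_bounded_linear[OF open_U bounded_linear_of_real])
  then show ?thesis
    using f_pos by (subst Cinf_on_cong[OF open_U]) (auto simp: cF_def Lfun_def less_imp_le)
qed

text \<open>\<open>Sb\<close> kills F because it kills L = F^2, so in J = dL0 / F^3 it acts on
  \<open>dL0\<close> alone. The definition of \<open>Kinv\<close> supplies the fourth factor
  1/F.\<close>

lemma Sb_dL0:
  assumes x: "x \<in> U"
  shows "Sb dL0 x = - Kinv f x * (cL x)\<^sup>2"
proof -
  have cF: "cF y \<noteq> 0" "cL y = cF y * cF y" if "y \<in> U" for y
    using f_pos[OF that] by (auto simp: cF_def cL_def Lfun_def power2_eq_square)
  have J: "Jfun f y = dL0 y * (inverse (cF y) * inverse (cF y) * inverse (cF y))" if y: "y \<in> U" for y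
  proof -
    have "Jfun f y = (\<Sum>k\<in>UNIV. (\<Sum>i\<in>UNIV. (\<Sum>j\<in>UNIV. gm f i j y * etabar j y)
        * (\<Sum>j\<in>UNIV. Lc f i j k y * eta j y)) * eta k y) * (inverse (cF y) * inverse (cF y) * inverse (cF y))"
      by (simp add: Jfun_def lup_def llow_def eta_def etabar_def cF_def sum_2 divide_inverse algebra_simps)
    then show ?thesis
      unfolding gm_etabar[OF y] Lc_eta[OF y] dL0_def Nc_Leta[OF y, symmetric]
      by (simp only: mult.commute[of "Leta _ y"])
  qed
  have inv: "sm (\<lambda>x. inverse (cF x))"
    using cF(1) by (intro Cinf_on_inverse open_U sm_cF)
  have "0 = Sb (\<lambda>x. cF x * cF x) x"
    using derivation_cong[OF derivation_on_Sb x, of cL "\<lambda>x. cF x * cF x"] cF(2) Sb_cL[OF x] by simp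
  then have Sb_cF: "Sb cF x = 0"
    using cF(1)[OF x] by (simp add: derivation_mult[OF derivation_on_Sb x] sm_cF)
  have "0 = Sb (\<lambda>x. cF x * inverse (cF x)) x"
    using derivation_cong[OF derivation_on_Sb x, of "\<lambda>x. cF x * inverse (cF x)" "\<lambda>_. 1"] cF(1)
      derivation_const[OF derivation_on_Sb x] by simp
  then have Sb_inv: "Sb (\<lambda>x. inverse (cF x)) x = 0"
    using cF(1)[OF x] Sb_cF by (simp add: derivation_mult[OF derivation_on_Sb x] sm_cF inv)
  have "Sb (Jfun f) x = Sb (\<lambda>x. dL0 x * (inverse (cF x) * inverse (cF x) * inverse (cF x))) x"
    by (rule derivation_cong[OF derivation_on_Sb x J])
  also have "\<dots> = Sb dL0 x * (inverse (cF x) * inverse (cF x) * inverse (cF x))"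
    by (simp add: derivation_mult[OF derivation_on_Sb x] Cinf_on_mult open_U sm_dL0 inv Sb_inv)
  finally have "Kinv f x = - inverse (cF x) * (Sb dL0 x * (inverse (cF x) * inverse (cF x) * inverse (cF x)))"
    by (simp add: Kinv_def Sb_def etabar_def cF_def divide_inverse)
  then show ?thesis using cF[OF x] by (simp add: field_simps power2_eq_square)
qed

text \<open>The metric and \<open>etabar\<close> combine to \<open>Leta\<close>, and
  \<open>Leta_Lc\<close> turns each of the two coefficients in \<open>Tc\<close> into a horizontal
  derivative.\<close>

lemma torsion_eq:
  assumes x: "x \<in> U"
  shows "(\<Sum>i\<in>UNIV. \<Sum>j\<in>UNIV. \<Sum>l\<in>UNIV. gm f i l x * Tc f i j k x * snd x $ j * cnj (snd x $ l))
    = (\<Sum>j\<in>UNIV. (hdel f k (Leta j) x - hdel f j (Leta k) x) * eta j x)"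
proof -
  have "(\<Sum>i\<in>UNIV. \<Sum>j\<in>UNIV. \<Sum>l\<in>UNIV. gm f i l x * Tc f i j k x * snd x $ j * cnj (snd x $ l))
    = (\<Sum>j\<in>UNIV. ((\<Sum>i\<in>UNIV. (\<Sum>l\<in>UNIV. gm f i l x * etabar l x) * Lc f i j k x)
      - (\<Sum>i\<in>UNIV. (\<Sum>l\<in>UNIV. gm f i l x * etabar l x) * Lc f i k j x)) * eta j x)"
    by (simp add: Tc_def eta_def etabar_def sum_2 algebra_simps)
  then show ?thesis unfolding gm_etabar[OF x] Leta_Lc[OF x] .
qed

lemma weakly_kaehler_in_chart:
  assumes K: "\<And>x. x \<in> U \<Longrightarrow> Kinv f x = \<kappa>" and "\<kappa> \<noteq> 0"
    and R: "\<And>x k. x \<in> U \<Longrightarrow> R_0k00 f k x = R_000k f k x"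
    and x: "x \<in> U"
  shows "(\<Sum>i\<in>UNIV. \<Sum>j\<in>UNIV. \<Sum>l\<in>UNIV. gm f i l x * Tc f i j k x * snd x $ j * cnj (snd x $ l)) = 0"
proof -
  have cL: "cL x \<noteq> 0" using f_pos[OF x] by (simp add: cL_def Lfun_def)
  \<comment> \<open>The two curvatures agree, so their sum \<open>2 \<kappa> L L_k\<close> is twice
    \<open>R_000k\<close>, that is, -2 times the left-hand side here.\<close>
  have hdel_dL0bar: "hdel f k dL0bar y = - \<kappa> * (cL y * Leta k y)" if y: "y \<in> U" for y k
  proof -
    have "deta k (Sb dL0) y = deta k (\<lambda>y. - \<kappa> * (cL y * cL y)) y"
      by (rule derivation_cong[OF derivation_on_coords(3) y]) (simp add: Sb_dL0 K power2_eq_square)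
    also have "\<dots> = - \<kappa> * deta k (\<lambda>y. cL y * cL y) y"
      by (intro derivation_cmult[OF derivation_on_coords(3) y] Cinf_on_mult open_U sm_cL)
    also have "\<dots> = - 2 * \<kappa> * (cL y * Leta k y)"
      by (simp add: derivation_mult[OF derivation_on_coords(3) y] sm_cL)
    finally show ?thesis
      using R_0k00_add_R_000k[OF y, of k] R[OF y, of k] R_000k_eq[OF y, of k] Sb_dz_cL[OF y, of k]
      by (simp add: minus_equation_iff[of "hdel f k dL0bar y"])
  qed
  have "hdel f j (hdel f k dL0bar) x = - \<kappa> * (cL x * hdel f j (Leta k) x)" for j k
  proof -
    have "hdel f j (hdel f k dL0bar) x = hdel f j (\<lambda>y. - \<kappa> * (cL y * Leta k y)) x"
      by (rule derivation_cong[OF derivation_on_hdel x hdel_dL0bar])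
    also have "\<dots> = - \<kappa> * hdel f j (\<lambda>y. cL y * Leta k y) x"
      by (intro derivation_cmult[OF derivation_on_hdel x] Cinf_on_mult open_U sm_cL sm_deriv)
    finally show ?thesis
      by (simp add: derivation_mult[OF derivation_on_hdel x] sm_cL sm_deriv hdel_cL x)
  qed
  \<comment> \<open>Horizontal derivatives commute, and the common factor -\<kappa>L is
    nonzero.\<close>
  then have "hdel f j (Leta k) x = hdel f k (Leta j) x" for j k
    using hdel_hdel[OF sm_dL0bar x, of j k] cL \<open>\<kappa> \<noteq> 0\<close> by simp
  then show ?thesis unfolding torsion_eq[OF x] by simp
qed

end

section \<open>From charts to the manifold\<close>

lemma chart_inv_image: "is_chart c \<Longrightarrow> z \<in> chart_image c \<Longrightarrow> chart_inv c z \<in> fst c \<and> snd c (chart_inv c z) = z"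
  unfolding is_chart_def homeomorphism_def by blast

lemma chart_inv_point: "is_chart c \<Longrightarrow> p \<in> fst c \<Longrightarrow> chart_inv c (snd c p) = p"
  unfolding is_chart_def homeomorphism_def by blast

lemma open_chart_overlap:
  assumes "is_chart c" "is_chart d"
  shows "open (snd c ` (fst c \<inter> fst d))"
proof -
  have "openin (top_of_set (chart_image c)) (snd c ` (fst c \<inter> fst d))"
    using assms unfolding is_chart_def
    by (intro homeomorphism_imp_open_map[of "fst c"]) (auto simp: openin_open)
  then show ?thesis using assms unfolding is_chart_def by (auto dest: openin_open_trans)
qed

text \<open>The atlas provides some complex linear derivative; derivatives are unique, so
  \<open>frechet_derivative\<close> is that one.\<close>

lemma transition_has_derivative:
  assumes "complex_atlas \<A>" "c \<in> \<A>" "d \<in> \<A>" "p \<in> fst c" "p \<in> fst d"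
  shows "(transition c d has_derivative frechet_derivative (transition c d) (at (snd c p))) (at (snd c p))"
    and "Vector_Spaces.linear (*s) (*s) (frechet_derivative (transition c d) (at (snd c p)))"
proof -
  have "holomorphic_map_on (transition c d) (snd c ` (fst c \<inter> fst d))"
    using assms unfolding complex_atlas_def by blast
  then obtain f' where "(transition c d has_derivative f') (at (snd c p))" "Vector_Spaces.linear (*s) (*s) f'"
    using assms unfolding holomorphic_map_on_def by blast
  with frechet_derivative_at[OF this(1)]
  show "(transition c d has_derivative frechet_derivative (transition c d) (at (snd c p))) (at (snd c p))"
    "Vector_Spaces.linear (*s) (*s) (frechet_derivative (transition c d) (at (snd c p)))" by auto
qed

text \<open>On the overlap of \<open>c\<close> and \<open>d\<close> the transition to
  \<open>e\<close> factors through \<open>d\<close>, with the same values near the point; the rest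
  is the chain rule.\<close>

lemma frechet_transition_compose:
  assumes \<A>: "complex_atlas \<A>" and "c \<in> \<A>" "d \<in> \<A>" "e \<in> \<A>" "p \<in> fst c" "p \<in> fst d" "p \<in> fst e"
  shows "frechet_derivative (transition c e) (at (snd c p)) v =
    frechet_derivative (transition d e) (at (snd d p)) (frechet_derivative (transition c d) (at (snd c p)) v)"
proof -
  have charts: "is_chart c" "is_chart d" using assms by (auto simp: complex_atlas_def)
  have p: "transition c d (snd c p) = snd d p"
    using chart_inv_point[OF charts(1) assms(5)] by (simp add: transition_def)
  have "frechet_derivative (transition c e) (at (snd c p)) =
      frechet_derivative (transition d e \<circ> transition c d) (at (snd c p))"
    using assms chart_inv_point[OF charts(1)] chart_inv_point[OF charts(2)]
    by (intro frechet_derivative_cong[OF open_chart_overlap[OF charts]]) (auto simp: transition_def)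
  also have "\<dots> = frechet_derivative (transition d e) (at (snd d p)) \<circ> frechet_derivative (transition c d) (at (snd c p))"
    using frechet_derivative_compose[of "transition c d" "snd c p" "transition d e"]
      transition_has_derivative(1)[OF \<A> assms(2,3,5,6)] transition_has_derivative(1)[OF \<A> assms(3,4,6,7)]
    unfolding p differentiable_def by blast
  finally show ?thesis by simp
qed

text \<open>The sign, zero and scaling axioms of \<open>complex_finsler\<close> speak only about
  members of \<open>tangent_space\<close>, so coordinate vectors must be shown to be such
  members.\<close>

lemma tvec_of_in_tangent_space:
  assumes "complex_atlas \<A>" "c \<in> \<A>" "p \<in> fst c"
  shows "tvec_of \<A> c p \<eta> \<in> tangent_space \<A> p"
proof -
  have "tvec_of \<A> c p \<eta> e = frechet_derivative (transition d e) (at (snd d p)) (tvec_of \<A> c p \<eta> d)"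
    if "d \<in> \<A>" "e \<in> \<A>" "p \<in> fst d \<inter> fst e" for d e
    using frechet_transition_compose[OF assms(1,2) that(1,2) assms(3), of \<eta>] that by (simp add: tvec_of_def)
  moreover have "tvec_of \<A> c p \<eta> d = 0" if "\<not> (d \<in> \<A> \<and> p \<in> fst d)" for d
    using that by (auto simp: tvec_of_def)
  ultimately show ?thesis unfolding tangent_space_def by blast
qed

lemma tvec_of_scale:
  assumes "complex_atlas \<A>" "c \<in> \<A>" "p \<in> fst c"
  shows "tvec_of \<A> c p (a *s \<eta>) = tscale a (tvec_of \<A> c p \<eta>)"
  by (auto simp: tvec_of_def tscale_def fun_eq_iff vec.linear_scale[OF transition_has_derivative(2)[OF assms(1,2) _ assms(3)]])

text \<open>The component in the chart \<open>c\<close> itself is \<eta>, because the transition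
  from \<open>c\<close> to \<open>c\<close> is the identity on the open set
  \<open>chart_image c\<close>.\<close>

lemma tvec_of_nonzero:
  assumes "complex_atlas \<A>" "c \<in> \<A>" "p \<in> fst c" "\<eta> \<noteq> 0"
  shows "tvec_of \<A> c p \<eta> \<noteq> tzero"
proof -
  have c: "is_chart c" using assms by (auto simp: complex_atlas_def)
  have "frechet_derivative (transition c c) (at (snd c p)) = frechet_derivative id (at (snd c p))"
    using assms c chart_inv_image[OF c]
    by (intro frechet_derivative_cong[of "chart_image c"]) (auto simp: transition_def is_chart_def chart_image_def)
  then have "tvec_of \<A> c p \<eta> c = \<eta>"
    using assms by (simp add: tvec_of_def)
  with assms(4) show ?thesis by (auto simp: tzero_def)
qed

lemma finsler_chart_in_chart:
  assumes \<A>: "complex_atlas \<A>" and F: "complex_finsler \<A> F" and c: "c \<in> \<A>"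
  shows "finsler_chart (in_chart \<A> F c) (chart_image c)"
proof
  have chart: "is_chart c" using assms by (auto simp: complex_atlas_def)
  note inv = chart_inv_image[OF chart, THEN conjunct1]
  note ts = tvec_of_in_tangent_space[OF \<A> c inv]
  show "open (chart_image c)" using chart by (simp add: is_chart_def)
  show "Cinf_on (Lfun (in_chart \<A> F c)) (chart_image c \<times> (UNIV - {0}))"
    using F c by (simp add: complex_finsler_def Cinf_on_smooth_on slit_def)
  show "hermitian_pos_def (gmat (in_chart \<A> F c) x)" if "x \<in> chart_image c \<times> (UNIV - {0})" for x
    using F c that unfolding complex_finsler_def slit_def by blast
  show "in_chart \<A> F c (z, a *s \<eta>) = cmod a * in_chart \<A> F c (z, \<eta>)"
    if "z \<in> chart_image c" for z \<eta> a
    using F ts[OF that] by (simp add: in_chart_def tvec_of_scale[OF \<A> c inv[OF that]] complex_finsler_def)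
  show "0 < in_chart \<A> F c x" if x: "x \<in> chart_image c \<times> (UNIV - {0})" for x
  proof -
    obtain z \<eta> where "x = (z, \<eta>)" "z \<in> chart_image c" "\<eta> \<noteq> 0" using x by auto
    moreover from this have "F (chart_inv c z) (tvec_of \<A> c (chart_inv c z) \<eta>) \<noteq> 0"
      "F (chart_inv c z) (tvec_of \<A> c (chart_inv c z) \<eta>) \<ge> 0"
      using F ts tvec_of_nonzero[OF \<A> c inv] unfolding complex_finsler_def by blast+
    ultimately show ?thesis by (simp add: in_chart_def)
  qed
qed

theorem theorem4p9:
  fixes \<A> :: "'a::{t2_space, second_countable_topology} chart set"
    and F :: "'a \<Rightarrow> 'a tvec \<Rightarrow> real"
  assumes "complex_atlas \<A>"
    and "connected (UNIV :: 'a set)"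
    and "complex_finsler \<A> F"
    and "\<forall>c\<in>\<A>. \<forall>x\<in>slit c. \<forall>k. R_0k00 (in_chart \<A> F c) k x = R_000k (in_chart \<A> F c) k x"
    and "\<exists>c\<in>\<A>. \<exists>x\<in>slit c. cmod (Ainv (in_chart \<A> F c) x) \<noteq> 0"
    and "\<exists>\<kappa>. \<kappa> \<noteq> 0 \<and> (\<forall>c\<in>\<A>. \<forall>x\<in>slit c. Kinv (in_chart \<A> F c) x = \<kappa>)"
  shows "weakly_kaehler \<A> F"
proof -
  obtain \<kappa> where \<kappa>: "\<kappa> \<noteq> 0" "\<And>c x. c \<in> \<A> \<Longrightarrow> x \<in> slit c \<Longrightarrow> Kinv (in_chart \<A> F c) x = \<kappa>"
    using assms(6) by blast
  show ?thesis
    unfolding weakly_kaehler_def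
  proof (intro ballI allI)
    fix c x k assume c: "c \<in> \<A>" and x: "x \<in> slit c"
    \<comment> \<open>Weak Kaehlerity is tested chart by chart, with the same \<kappa> in each, so
      the result for one chart applies.\<close>
    interpret finsler_chart "in_chart \<A> F c" "chart_image c"
      by (rule finsler_chart_in_chart[OF assms(1,3) c])
    show "(\<Sum>i\<in>UNIV. \<Sum>j\<in>UNIV. \<Sum>l\<in>UNIV.
        gm (in_chart \<A> F c) i l x * Tc (in_chart \<A> F c) i j k x * snd x $ j * cnj (snd x $ l)) = 0"
      by (rule weakly_kaehler_in_chart[folded slit_def, OF \<kappa>(2)[OF c] \<kappa>(1) _ x]) (simp_all add: assms(4) c)
  qed
qed

end
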